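(* Let $(M,g)$ be a compact Riemannian manifold of dimension $n\ge 2$, let $(\bar M,\bar g)$ be a Riemannian manifold of dimension $m\ge 2$, and let $f:(M,g)\to(\bar M,\bar g)$ be a smooth map. Let $g^*:=f^*\bar g$ be the pullback metric and $e(f):=\operatorname{trace}_g g^*$ the energy density. If $f$ is harmonic, then $$\delta g^*=-\tfrac12\,d\,e(f).$$ Conversely, suppose that $\delta g^*=-\tfrac12\,d\,e(f)$ holds on $M$. If, in addition, either (i) $n=m$ and $f$ is a diffeomorphism, or (ii) $n>m$ and $f$ is a submersion, then $f$ is harmonic.
   Context: $\nabla$ and $\bar\nabla$ denote the Levi-Civita connections of $g$ and $\bar g$. The differential $f_*$ is a section of $T^*M\otimes f^*T\bar M$, and $(Df_* )(X,Y)=\bar\nabla'_X(f_*Y)-f_*(\nabla_XY)$, where $\bar\nabla'$ is the pullback connection on $f^*T\bar M$. The tension field is $\tau(f)=\operatorname{trace}_g(Df_* )$, and $f$ is harmonic if $\tau(f)=0$ (equivalently, if $f$ is a critical point of $E(f)=\frac12\int_M e(f)\,dv_g$). The tensor $g^*=f^*\bar g$ is a symmetric 2-tensor field on $M$ (possibly degenerate). The divergence operator on symmetric 2-tensors is $(\delta\varphi)(Y)=-\sum_i(\nabla_{e_i}\varphi)(e_i,Y)$ for a local $g$-orthonormal frame $(e_i)$; it is the formal $L^2$-adjoint of $\delta^*\theta=\frac12\mathcal L_{\theta^\sharp}g$. *)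

theory Defs
  imports "HOL-Analysis.Analysis"
begin

section \<open>Smooth maps between Euclidean spaces\<close>

text \<open>Only used for open sets \<open>S\<close>.\<close>

primrec Ck_on :: "nat \<Rightarrow> 'a::real_normed_vector set \<Rightarrow> ('a \<Rightarrow> 'b::real_normed_vector) \<Rightarrow> bool" where
  "Ck_on 0 S f \<longleftrightarrow> continuous_on S f"
| "Ck_on (Suc k) S f \<longleftrightarrow>
     (\<forall>x\<in>S. f differentiable (at x)) \<and> (\<forall>v. Ck_on k S (\<lambda>x. frechet_derivative f (at x) v))"

definition smooth_on :: "'a::real_normed_vector set \<Rightarrow> ('a \<Rightarrow> 'b::real_normed_vector) \<Rightarrow> bool" where
  "smooth_on S f \<longleftrightarrow> (\<forall>k. Ck_on k S f)"


section \<open>Manifolds\<close>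

type_synonym ('a, 'n) chart = "'a set \<times> ('a \<Rightarrow> real ^ 'n)"

definition cinv :: "('a, 'n) chart \<Rightarrow> real ^ 'n \<Rightarrow> 'a" where
  "cinv c = inv_into (fst c) (snd c)"

definition crange :: "('a, 'n) chart \<Rightarrow> (real ^ 'n) set" where
  "crange c = snd c ` fst c"

text \<open>
  The tangent space at \<open>p\<close> is \<open>real ^ 'n\<close>: a tangent vector is represented by its components in
  one fixed chart \<open>chart_at M p\<close> around \<open>p\<close>, and its components in any other chart are obtained by
  applying the derivative of the transition map (see \<open>tan_comp\<close> and \<open>tan_vec\<close> below).
  The field \<open>metric\<close> gives a bilinear form on each of these tangent spaces.
\<close>

record ('a, 'n::finite) rmanifold =
  mtop :: "'a topology"
  atlas :: "('a, 'n) chart set"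
  metric :: "'a \<Rightarrow> real ^ 'n \<Rightarrow> real ^ 'n \<Rightarrow> real"

abbreviation pts :: "('a, 'n::finite) rmanifold \<Rightarrow> 'a set" where
  "pts M \<equiv> topspace (mtop M)"

definition smooth_manifold :: "('a, 'n::finite) rmanifold \<Rightarrow> bool" where
  "smooth_manifold M \<longleftrightarrow>
     Hausdorff_space (mtop M) \<and> second_countable (mtop M) \<and>
     (\<Union>c\<in>atlas M. fst c) = pts M \<and>
     (\<forall>c\<in>atlas M. openin (mtop M) (fst c) \<and> open (crange c) \<and>
        homeomorphic_map (subtopology (mtop M) (fst c)) (top_of_set (crange c)) (snd c)) \<and>
     (\<forall>c\<in>atlas M. \<forall>d\<in>atlas M. smooth_on (snd c ` (fst c \<inter> fst d)) (snd d \<circ> cinv c))"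

definition chart_at :: "('a, 'n::finite) rmanifold \<Rightarrow> 'a \<Rightarrow> ('a, 'n) chart" where
  "chart_at M p = (SOME c. c \<in> atlas M \<and> p \<in> fst c)"

text \<open>Components in the chart \<open>c\<close> of the tangent vector \<open>v\<close> at \<open>p\<close>.\<close>

definition tan_comp :: "('a, 'n::finite) rmanifold \<Rightarrow> ('a, 'n) chart \<Rightarrow> 'a \<Rightarrow> real ^ 'n \<Rightarrow> real ^ 'n" where
  "tan_comp M c p v =
     frechet_derivative (snd c \<circ> cinv (chart_at M p)) (at (snd (chart_at M p) p)) v"

text \<open>The tangent vector at \<open>p\<close> with components \<open>u\<close> in the chart \<open>c\<close>.\<close>

definition tan_vec :: "('a, 'n::finite) rmanifold \<Rightarrow> ('a, 'n) chart \<Rightarrow> 'a \<Rightarrow> real ^ 'n \<Rightarrow> real ^ 'n" where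
  "tan_vec M c p u =
     frechet_derivative (snd (chart_at M p) \<circ> cinv c) (at (snd c p)) u"

text \<open>The derivative of a function in the direction of the tangent vector \<open>v\<close> at \<open>p\<close>.\<close>

definition dfun :: "('a, 'n::finite) rmanifold \<Rightarrow> ('a \<Rightarrow> 'v::real_normed_vector) \<Rightarrow> 'a \<Rightarrow> real ^ 'n \<Rightarrow> 'v" where
  "dfun M h p v = frechet_derivative (h \<circ> cinv (chart_at M p)) (at (snd (chart_at M p) p)) v"

definition smooth_map :: "('a, 'n::finite) rmanifold \<Rightarrow> ('b, 'm::finite) rmanifold \<Rightarrow> ('a \<Rightarrow> 'b) \<Rightarrow> bool" where
  "smooth_map M N f \<longleftrightarrow>
     continuous_map (mtop M) (mtop N) f \<and>
     (\<forall>c\<in>atlas M. \<forall>d\<in>atlas N. smooth_on (snd c ` (fst c \<inter> f -` fst d)) (snd d \<circ> f \<circ> cinv c))"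

text \<open>The differential \<open>f\<^sub>*\<close>, mapping the tangent space at \<open>p\<close> to the one at \<open>f p\<close>.\<close>

definition differential ::
  "('a, 'n::finite) rmanifold \<Rightarrow> ('b, 'm::finite) rmanifold \<Rightarrow> ('a \<Rightarrow> 'b) \<Rightarrow> 'a \<Rightarrow> real ^ 'n \<Rightarrow> real ^ 'm" where
  "differential M N f p v = dfun M (snd (chart_at N (f p)) \<circ> f) p v"

definition diffeomorphism :: "('a, 'n::finite) rmanifold \<Rightarrow> ('b, 'm::finite) rmanifold \<Rightarrow> ('a \<Rightarrow> 'b) \<Rightarrow> bool" where
  "diffeomorphism M N f \<longleftrightarrow>
     bij_betw f (pts M) (pts N) \<and> smooth_map M N f \<and> smooth_map N M (inv_into (pts M) f)"

definition submersion :: "('a, 'n::finite) rmanifold \<Rightarrow> ('b, 'm::finite) rmanifold \<Rightarrow> ('a \<Rightarrow> 'b) \<Rightarrow> bool" where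
  "submersion M N f \<longleftrightarrow> smooth_map M N f \<and> (\<forall>p\<in>pts M. surj (differential M N f p))"


section \<open>Riemannian metrics and the Levi-Civita connection\<close>

text \<open>The matrix \<open>(g\<^sub>i\<^sub>j)\<close> of the metric in the chart \<open>c\<close>, as a function of the coordinates.\<close>

definition gram :: "('a, 'n::finite) rmanifold \<Rightarrow> ('a, 'n) chart \<Rightarrow> real ^ 'n \<Rightarrow> real ^ 'n ^ 'n" where
  "gram M c x =
     (let q = cinv c x in
       \<chi> i j. metric M q (tan_vec M c q (axis i 1)) (tan_vec M c q (axis j 1)))"

definition riemannian_manifold :: "('a, 'n::finite) rmanifold \<Rightarrow> bool" where
  "riemannian_manifold M \<longleftrightarrow>
     smooth_manifold M \<and>
     (\<forall>p\<in>pts M. bilinear (metric M p) \<and>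
        (\<forall>u v. metric M p u v = metric M p v u) \<and>
        (\<forall>v. v \<noteq> 0 \<longrightarrow> metric M p v v > 0)) \<and>
     (\<forall>c\<in>atlas M. smooth_on (crange c) (gram M c))"

definition partial :: "'n \<Rightarrow> (real ^ 'n::finite \<Rightarrow> real) \<Rightarrow> real ^ 'n \<Rightarrow> real" where
  "partial i h x = frechet_derivative h (at x) (axis i 1)"

definition christoffel ::
  "('a, 'n::finite) rmanifold \<Rightarrow> ('a, 'n) chart \<Rightarrow> real ^ 'n \<Rightarrow> 'n \<Rightarrow> 'n \<Rightarrow> 'n \<Rightarrow> real" where
  "christoffel M c x k i j =
     1/2 * (\<Sum>l\<in>UNIV. matrix_inv (gram M c x) $ k $ l *
       (partial i (\<lambda>y. gram M c y $ j $ l) x + partial j (\<lambda>y. gram M c y $ i $ l) x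
        - partial l (\<lambda>y. gram M c y $ i $ j) x))"

definition christoffel_form ::
  "('a, 'n::finite) rmanifold \<Rightarrow> ('a, 'n) chart \<Rightarrow> 'a \<Rightarrow> real ^ 'n \<Rightarrow> real ^ 'n \<Rightarrow> real ^ 'n" where
  "christoffel_form M c p u w =
     (\<chi> k. \<Sum>i\<in>UNIV. \<Sum>j\<in>UNIV. christoffel M c (snd c p) k i j * u $ i * w $ j)"

text \<open>
  \<open>pullback_conn M N f V p v\<close> is \<open>\<nabla>'\<^sub>v V\<close>, for a tangent vector \<open>v\<close> at \<open>p\<close> and a section \<open>V\<close> of the
  pullback by \<open>f\<close> of the tangent bundle of \<open>N\<close>, i.e. \<open>V q\<close> is a tangent vector of \<open>N\<close> at \<open>f q\<close>.
  The Levi-Civita connection of \<open>M\<close> itself is \<open>levi_civita M\<close>. By the choice of the chart at \<open>f p\<close>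
  (respectively \<open>p\<close>), the components computed here are those of an element of the tangent space.
\<close>

definition pullback_conn ::
  "('a, 'n::finite) rmanifold \<Rightarrow> ('b, 'm::finite) rmanifold \<Rightarrow> ('a \<Rightarrow> 'b) \<Rightarrow>
   ('a \<Rightarrow> real ^ 'm) \<Rightarrow> 'a \<Rightarrow> real ^ 'n \<Rightarrow> real ^ 'm" where
  "pullback_conn M N f V p v =
     (let d = chart_at N (f p) in
       dfun M (\<lambda>q. tan_comp N d (f q) (V q)) p v
       + christoffel_form N d (f p) (differential M N f p v) (V p))"

definition levi_civita :: "('a, 'n::finite) rmanifold \<Rightarrow> ('a \<Rightarrow> real ^ 'n) \<Rightarrow> 'a \<Rightarrow> real ^ 'n \<Rightarrow> real ^ 'n" where
  "levi_civita M Y p v =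
     (let c = chart_at M p in
       dfun M (\<lambda>q. tan_comp M c q (Y q)) p v + christoffel_form M c p v (Y p))"

text \<open>
  The local vector field that extends the tangent vector \<open>w\<close> at \<open>p\<close> with constant components in
  the chart at \<open>p\<close>. The expressions below in which such extensions occur are tensorial, so that
  their values do not depend on the extension.
\<close>

definition extend :: "('a, 'n::finite) rmanifold \<Rightarrow> 'a \<Rightarrow> real ^ 'n \<Rightarrow> 'a \<Rightarrow> real ^ 'n" where
  "extend M p w q = tan_vec M (chart_at M p) q w"

definition ortho_basis :: "('a, 'n::finite) rmanifold \<Rightarrow> 'a \<Rightarrow> ('n \<Rightarrow> real ^ 'n) \<Rightarrow> bool" where
  "ortho_basis M p e \<longleftrightarrow> (\<forall>i j. metric M p (e i) (e j) = (if i = j then 1 else 0))"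

definition trace_g ::
  "('a, 'n::finite) rmanifold \<Rightarrow> 'a \<Rightarrow> (real ^ 'n \<Rightarrow> real ^ 'n \<Rightarrow> 'v::comm_monoid_add) \<Rightarrow> 'v" where
  "trace_g M p A = (let e = (SOME e. ortho_basis M p e) in \<Sum>i\<in>UNIV. A (e i) (e i))"

type_synonym ('a, 'n) tensor2 = "'a \<Rightarrow> real ^ 'n \<Rightarrow> real ^ 'n \<Rightarrow> real"

text \<open>\<open>nabla2 M \<phi> p u v w\<close> is \<open>(\<nabla>\<^sub>u \<phi>)(v, w)\<close>.\<close>

definition nabla2 ::
  "('a, 'n::finite) rmanifold \<Rightarrow> ('a, 'n) tensor2 \<Rightarrow> 'a \<Rightarrow> real ^ 'n \<Rightarrow> real ^ 'n \<Rightarrow> real ^ 'n \<Rightarrow> real" where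
  "nabla2 M \<phi> p u v w =
     (let V = extend M p v; W = extend M p w in
       dfun M (\<lambda>q. \<phi> q (V q) (W q)) p u
       - \<phi> p (levi_civita M V p u) w - \<phi> p v (levi_civita M W p u))"

definition divergence :: "('a, 'n::finite) rmanifold \<Rightarrow> ('a, 'n) tensor2 \<Rightarrow> 'a \<Rightarrow> real ^ 'n \<Rightarrow> real" where
  "divergence M \<phi> p w = - trace_g M p (\<lambda>u v. nabla2 M \<phi> p u v w)"


section \<open>Harmonic maps\<close>

definition pullback_metric ::
  "('a, 'n::finite) rmanifold \<Rightarrow> ('b, 'm::finite) rmanifold \<Rightarrow> ('a \<Rightarrow> 'b) \<Rightarrow> ('a, 'n) tensor2" where
  "pullback_metric M N f p u v = metric N (f p) (differential M N f p u) (differential M N f p v)"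

definition energy_density ::
  "('a, 'n::finite) rmanifold \<Rightarrow> ('b, 'm::finite) rmanifold \<Rightarrow> ('a \<Rightarrow> 'b) \<Rightarrow> 'a \<Rightarrow> real" where
  "energy_density M N f p = trace_g M p (pullback_metric M N f p)"

text \<open>\<open>D_differential M N f p u v\<close> is \<open>(D f\<^sub>*)(u, v) = \<nabla>'\<^sub>u (f\<^sub>* V) - f\<^sub>* (\<nabla>\<^sub>u V)\<close>.\<close>

definition D_differential ::
  "('a, 'n::finite) rmanifold \<Rightarrow> ('b, 'm::finite) rmanifold \<Rightarrow> ('a \<Rightarrow> 'b) \<Rightarrow> 'a \<Rightarrow>
   real ^ 'n \<Rightarrow> real ^ 'n \<Rightarrow> real ^ 'm" where
  "D_differential M N f p u v =
     (let V = extend M p v in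
       pullback_conn M N f (\<lambda>q. differential M N f q (V q)) p u
       - differential M N f p (levi_civita M V p u))"

definition tension ::
  "('a, 'n::finite) rmanifold \<Rightarrow> ('b, 'm::finite) rmanifold \<Rightarrow> ('a \<Rightarrow> 'b) \<Rightarrow> 'a \<Rightarrow> real ^ 'm" where
  "tension M N f p = trace_g M p (D_differential M N f p)"

definition harmonic :: "('a, 'n::finite) rmanifold \<Rightarrow> ('b, 'm::finite) rmanifold \<Rightarrow> ('a \<Rightarrow> 'b) \<Rightarrow> bool" where
  "harmonic M N f \<longleftrightarrow> (\<forall>p\<in>pts M. tension M N f p = 0)"



section \<open>Basic facts\<close>

text \<open>
  The connection is torsion-free (\<open>levi_civita_torsion_free\<close>, for coordinate vector fields) and
  metric (\<open>levi_civita_metric\<close>), and orthonormal bases exist (\<open>ex_ortho_basis\<close>).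
\<close>

lemma smooth_on_imp_differentiable:
  assumes "smooth_on S f" "x \<in> S"
  shows "f differentiable (at x)"
proof -
  have "Ck_on (Suc 0) S f" using assms(1) unfolding smooth_on_def by blast
  then show ?thesis using assms(2) by simp
qed

lemma chart_at:
  assumes "smooth_manifold M" "p \<in> pts M"
  shows "chart_at M p \<in> atlas M" "p \<in> fst (chart_at M p)"
proof -
  have "\<exists>c. c \<in> atlas M \<and> p \<in> fst c" using assms unfolding smooth_manifold_def by blast
  from someI_ex[OF this] show "chart_at M p \<in> atlas M" "p \<in> fst (chart_at M p)"
    unfolding chart_at_def by auto
qed

lemma chart_subset:
  assumes "smooth_manifold M" "c \<in> atlas M"
  shows "fst c \<subseteq> pts M"
  using assms unfolding smooth_manifold_def by blast

lemma chart_inj: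
  assumes "smooth_manifold M" "c \<in> atlas M"
  shows "inj_on (snd c) (fst c)"
proof -
  have "homeomorphic_map (subtopology (mtop M) (fst c)) (top_of_set (crange c)) (snd c)"
    using assms unfolding smooth_manifold_def by blast
  from homeomorphic_imp_injective_map[OF this] chart_subset[OF assms] show ?thesis
    by (simp add: topspace_subtopology Int_absorb1)
qed

lemma cinv_chart:
  assumes "smooth_manifold M" "c \<in> atlas M" "q \<in> fst c"
  shows "cinv c (snd c q) = q"
  using chart_inj[OF assms(1,2)] assms(3) by (simp add: cinv_def)

lemma chart_Int_open:
  assumes "smooth_manifold M" "c \<in> atlas M" "d \<in> atlas M"
  shows "open (snd c ` (fst c \<inter> fst d))"
proof -
  let ?T = "subtopology (mtop M) (fst c)"
  have h: "homeomorphic_map ?T (top_of_set (crange c)) (snd c)"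
    and o: "openin (mtop M) (fst d)" "open (crange c)"
    using assms unfolding smooth_manifold_def by blast+
  have "openin ?T (fst c \<inter> fst d)" using o(1) by (metis inf_commute openin_subtopology_Int)
  then have "openin (top_of_set (crange c)) (snd c ` (fst c \<inter> fst d))"
    using h by (meson homeomorphic_imp_open_map open_map_def)
  then show ?thesis using o(2) by (meson openin_open_trans)
qed

lemma tan_comp_tan_vec:
  assumes M: "smooth_manifold M" and c: "c \<in> atlas M" "q \<in> fst c"
  shows "tan_comp M c q (tan_vec M c q w) = w"
proof -
  define e where "e = chart_at M q"
  have e: "e \<in> atlas M" "q \<in> fst e"
    using chart_at[OF M, of q] chart_subset[OF M c(1)] c(2) by (auto simp: e_def)
  let ?F = "snd c \<circ> cinv e" and ?G = "snd e \<circ> cinv c"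
  let ?S = "snd c ` (fst c \<inter> fst e)"
  have "smooth_on (snd e ` (fst e \<inter> fst c)) ?F" "smooth_on ?S ?G"
    using M c e unfolding smooth_manifold_def by blast+
  then have "?F differentiable (at (snd e q))" "?G differentiable (at (snd c q))"
    using c e by (auto intro!: smooth_on_imp_differentiable)
  then have dF: "(?F has_derivative frechet_derivative ?F (at (snd e q))) (at (?G (snd c q)))"
    and dG: "(?G has_derivative frechet_derivative ?G (at (snd c q))) (at (snd c q))"
    using c e by (simp_all add: frechet_derivative_works cinv_chart[OF M])
  have "(?F \<circ> ?G has_derivative frechet_derivative ?F (at (snd e q)) \<circ> frechet_derivative ?G (at (snd c q)))
          (at (snd c q))"
    using diff_chain_at[OF dG dF] .
  moreover have "(?F \<circ> ?G has_derivative id) (at (snd c q))"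
  proof (rule has_derivative_transform_within_open)
    show "(id has_derivative id) (at (snd c q))" by (rule has_derivative_id)
    show "open ?S" by (rule chart_Int_open[OF M c(1) e(1)])
    show "snd c q \<in> ?S" using c e by blast
    fix x assume "x \<in> ?S"
    then show "id x = (?F \<circ> ?G) x" using c(1) e(1) by (auto simp: cinv_chart[OF M])
  qed
  ultimately have "frechet_derivative ?F (at (snd e q)) \<circ> frechet_derivative ?G (at (snd c q)) = id"
    by (rule has_derivative_unique)
  then show ?thesis
    unfolding tan_comp_def tan_vec_def e_def[symmetric] by (metis comp_apply id_apply)
qed

lemma crange_open:
  assumes "smooth_manifold M" "c \<in> atlas M"
  shows "open (crange c)"
  using assms unfolding smooth_manifold_def by blast

lemma cinv_in:
  assumes "x \<in> crange c" shows "cinv c x \<in> fst c" "snd c (cinv c x) = x"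
  using assms by (auto simp: cinv_def crange_def inv_into_into f_inv_into_f)

lemma tan_vec_chart_at:
  assumes M: "smooth_manifold M" and p: "p \<in> pts M"
  shows "tan_vec M (chart_at M p) p w = w"
proof -
  let ?c = "chart_at M p"
  note c = chart_at[OF M p]
  have "(snd ?c \<circ> cinv ?c has_derivative id) (at (snd ?c p))"
  proof (rule has_derivative_transform_within_open)
    show "(id has_derivative id) (at (snd ?c p))" by (rule has_derivative_id)
    show "open (crange ?c)" by (rule crange_open[OF M c(1)])
    show "snd ?c p \<in> crange ?c" using c by (simp add: crange_def)
    fix x assume "x \<in> crange ?c"
    then show "id x = (snd ?c \<circ> cinv ?c) x" by (simp add: cinv_in)
  qed
  then have "frechet_derivative (snd ?c \<circ> cinv ?c) (at (snd ?c p)) = id"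
    by (metis frechet_derivative_at)
  then show ?thesis by (simp add: tan_vec_def)
qed

lemma levi_civita_extend:
  assumes M: "smooth_manifold M" and p: "p \<in> pts M"
  shows "levi_civita M (extend M p w) p u = christoffel_form M (chart_at M p) p u w"
proof -
  let ?c = "chart_at M p"
  let ?h = "(\<lambda>q. tan_comp M ?c q (extend M p w q)) \<circ> cinv ?c"
  note c = chart_at[OF M p]
  have "(?h has_derivative (\<lambda>_. 0)) (at (snd ?c p))"
  proof (rule has_derivative_transform_within_open)
    show "((\<lambda>_. w) has_derivative (\<lambda>_. 0)) (at (snd ?c p))" by simp
    show "open (crange ?c)" by (rule crange_open[OF M c(1)])
    show "snd ?c p \<in> crange ?c" using c by (simp add: crange_def)
    fix x assume "x \<in> crange ?c"
    then show "w = ?h x"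
      by (simp add: extend_def tan_comp_tan_vec[OF M c(1)] cinv_in)
  qed
  then have "frechet_derivative ?h (at (snd ?c p)) = (\<lambda>_. 0)" by (metis frechet_derivative_at)
  then show ?thesis
    by (simp add: levi_civita_def Let_def dfun_def extend_def tan_vec_chart_at[OF M p])
qed

lemma gram_symmetric:
  assumes "riemannian_manifold M" "c \<in> atlas M" "x \<in> crange c"
  shows "gram M c x $ i $ j = gram M c x $ j $ i"
proof -
  have "cinv c x \<in> pts M"
    using assms cinv_in chart_subset unfolding riemannian_manifold_def by blast
  then show ?thesis using assms(1) unfolding riemannian_manifold_def gram_def Let_def by simp
qed

lemma gram_entry_differentiable:
  assumes "riemannian_manifold M" "c \<in> atlas M" "x \<in> crange c"
  shows "(\<lambda>y. gram M c y $ i $ j) differentiable (at x)"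
proof -
  have "gram M c differentiable (at x)"
    using assms unfolding riemannian_manifold_def by (blast intro: smooth_on_imp_differentiable)
  then obtain D where "(gram M c has_derivative D) (at x)" unfolding differentiable_def by blast
  then have "((\<lambda>y. gram M c y $ i $ j) has_derivative (\<lambda>z. D z $ i $ j)) (at x)"
    by (intro bounded_linear.has_derivative[OF bounded_linear_vec_nth])
  then show ?thesis unfolding differentiable_def by blast
qed

lemma partial_gram_symmetric:
  assumes "riemannian_manifold M" "c \<in> atlas M" "x \<in> crange c"
  shows "partial l (\<lambda>y. gram M c y $ i $ j) x = partial l (\<lambda>y. gram M c y $ j $ i) x"
proof -
  have M: "smooth_manifold M" using assms(1) by (simp add: riemannian_manifold_def)
  note d = gram_entry_differentiable[OF assms]
  have "((\<lambda>y. gram M c y $ j $ i) has_derivative frechet_derivative (\<lambda>y. gram M c y $ i $ j) (at x)) (at x)"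
    by (rule has_derivative_transform_within_open[OF d[of i j, unfolded frechet_derivative_works]
          crange_open[OF M assms(2)] assms(3)])
       (rule gram_symmetric[OF assms(1,2)])
  then show ?thesis unfolding partial_def by (metis frechet_derivative_at)
qed

lemma levi_civita_torsion_free:
  assumes R: "riemannian_manifold M" and p: "p \<in> pts M"
  shows "levi_civita M (extend M p w) p u = levi_civita M (extend M p u) p w"
proof -
  let ?c = "chart_at M p"
  have M: "smooth_manifold M" using R by (simp add: riemannian_manifold_def)
  note c = chart_at[OF M p]
  have x: "snd ?c p \<in> crange ?c" using c by (simp add: crange_def)
  have "christoffel M ?c (snd ?c p) k i j = christoffel M ?c (snd ?c p) k j i" for k i j
    unfolding christoffel_def partial_gram_symmetric[OF R c(1) x, of _ i j] by (simp add: add.commute)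
  then have "(\<Sum>i\<in>UNIV. \<Sum>j\<in>UNIV. christoffel M ?c (snd ?c p) k i j * u $ i * w $ j) =
             (\<Sum>i\<in>UNIV. \<Sum>j\<in>UNIV. christoffel M ?c (snd ?c p) k i j * w $ i * u $ j)" for k
    by (subst sum.swap) (simp add: mult_ac)
  then show ?thesis by (simp add: levi_civita_extend[OF M p] christoffel_form_def)
qed

lemma gram_expand:
  assumes R: "riemannian_manifold M" and c: "c \<in> atlas M" and x: "x \<in> crange c"
  shows "metric M (cinv c x) (tan_vec M c (cinv c x) v) (tan_vec M c (cinv c x) w) =
         (\<Sum>i\<in>UNIV. \<Sum>j\<in>UNIV. gram M c x $ i $ j * v $ i * w $ j)"
proof -
  let ?q = "cinv c x"
  have M: "smooth_manifold M" using R by (simp add: riemannian_manifold_def)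
  have q: "?q \<in> fst c" "snd c ?q = x" using cinv_in[OF x] by auto
  have qp: "?q \<in> pts M" using q chart_subset[OF M c] by blast
  have bil: "bilinear (metric M ?q)" using R qp by (simp add: riemannian_manifold_def)
  let ?e = "chart_at M ?q"
  note e = chart_at[OF M qp]
  have "smooth_on (snd c ` (fst c \<inter> fst ?e)) (snd ?e \<circ> cinv c)"
    using M c e unfolding smooth_manifold_def by blast
  then have "(snd ?e \<circ> cinv c) differentiable (at (snd c ?q))"
    using q e by (intro smooth_on_imp_differentiable) (blast intro: image_eqI)+
  then have lin: "linear (tan_vec M c ?q)"
    unfolding tan_vec_def by (rule linear_frechet_derivative)
  have ex: "tan_vec M c ?q v = (\<Sum>i\<in>UNIV. v $ i *\<^sub>R tan_vec M c ?q (axis i 1))" for v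
  proof -
    have "v = (\<Sum>i\<in>UNIV. v $ i *\<^sub>R axis i 1)"
      using basis_expansion[of v] by (simp add: scalar_mult_eq_scaleR)
    then have "tan_vec M c ?q v = tan_vec M c ?q (\<Sum>i\<in>UNIV. v $ i *\<^sub>R axis i 1)" by simp
    also have "\<dots> = (\<Sum>i\<in>UNIV. v $ i *\<^sub>R tan_vec M c ?q (axis i 1))"
      by (simp add: linear_sum[OF lin] linear_cmul[OF lin])
    finally show ?thesis .
  qed
  have "metric M ?q (tan_vec M c ?q v) (tan_vec M c ?q w) =
     (\<Sum>(i,j)\<in>UNIV \<times> UNIV. metric M ?q (v $ i *\<^sub>R tan_vec M c ?q (axis i 1)) (w $ j *\<^sub>R tan_vec M c ?q (axis j 1)))"
    by (subst ex[of v], subst ex[of w]) (rule bilinear_sum[OF bil])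
  also have "\<dots> = (\<Sum>i\<in>UNIV. \<Sum>j\<in>UNIV. gram M c x $ i $ j * v $ i * w $ j)"
    unfolding sum.cartesian_product[symmetric]
    by (simp add: bilinear_lmul[OF bil] bilinear_rmul[OF bil]
          gram_def Let_def mult_ac)
  finally show ?thesis .
qed

text \<open>Christoffel symbols of the first kind.\<close>

definition christoffel1 ::
  "('a, 'n::finite) rmanifold \<Rightarrow> ('a, 'n) chart \<Rightarrow> real ^ 'n \<Rightarrow> 'n \<Rightarrow> 'n \<Rightarrow> 'n \<Rightarrow> real" where
  "christoffel1 M c x l i j =
     1/2 * (partial i (\<lambda>y. gram M c y $ j $ l) x + partial j (\<lambda>y. gram M c y $ i $ l) x
        - partial l (\<lambda>y. gram M c y $ i $ j) x)"

lemma metric_expand: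
  assumes R: "riemannian_manifold M" and p: "p \<in> pts M"
  shows "metric M p v w =
    (\<Sum>i\<in>UNIV. \<Sum>j\<in>UNIV. gram M (chart_at M p) (snd (chart_at M p) p) $ i $ j * v $ i * w $ j)"
proof -
  have M: "smooth_manifold M" using R by (simp add: riemannian_manifold_def)
  note c = chart_at[OF M p]
  have x: "snd (chart_at M p) p \<in> crange (chart_at M p)" using c by (simp add: crange_def)
  show ?thesis
    using gram_expand[OF R c(1) x, of v w]
    by (simp add: cinv_chart[OF M c] tan_vec_chart_at[OF M p])
qed

lemma gram_inverse:
  assumes R: "riemannian_manifold M" and p: "p \<in> pts M"
  shows "gram M (chart_at M p) (snd (chart_at M p) p) ** matrix_inv (gram M (chart_at M p) (snd (chart_at M p) p)) = mat 1"
proof -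
  let ?G = "gram M (chart_at M p) (snd (chart_at M p) p)"
  have "v = 0" if "?G *v v = 0" for v
  proof (rule ccontr)
    assume "v \<noteq> 0"
    then have "metric M p v v > 0" using R p by (simp add: riemannian_manifold_def)
    moreover have "metric M p v v = v \<bullet> (?G *v v)"
      by (simp add: metric_expand[OF R p] inner_vec_def matrix_vector_mult_def sum_distrib_left mult_ac)
    ultimately show False using that by simp
  qed
  then have "\<exists>B. B ** ?G = mat 1" by (subst matrix_left_invertible_ker) blast
  then have "\<exists>B. ?G ** B = mat 1 \<and> B ** ?G = mat 1" using matrix_left_right_inverse by blast
  from someI_ex[OF this] show ?thesis unfolding matrix_inv_def by blast
qed

lemma gram_christoffel:
  assumes R: "riemannian_manifold M" and p: "p \<in> pts M"
  shows "(\<Sum>k\<in>UNIV. gram M (chart_at M p) (snd (chart_at M p) p) $ k $ b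
             * christoffel M (chart_at M p) (snd (chart_at M p) p) k i j)
         = christoffel1 M (chart_at M p) (snd (chart_at M p) p) b i j"
proof -
  let ?x = "snd (chart_at M p) p"
  let ?G = "gram M (chart_at M p) ?x"
  let ?I = "matrix_inv ?G"
  let ?L = "\<lambda>l. christoffel1 M (chart_at M p) ?x l i j"
  have M: "smooth_manifold M" using R by (simp add: riemannian_manifold_def)
  note c = chart_at[OF M p]
  have x: "?x \<in> crange (chart_at M p)" using c by (simp add: crange_def)
  have "(\<Sum>k\<in>UNIV. ?G $ k $ b * christoffel M (chart_at M p) ?x k i j)
      = (\<Sum>k\<in>UNIV. \<Sum>l\<in>UNIV. ?G $ b $ k * ?I $ k $ l * ?L l)"
    unfolding christoffel_def christoffel1_def gram_symmetric[OF R c(1) x, of _ b]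
    by (simp add: sum_distrib_left mult_ac)
  also have "\<dots> = (\<Sum>l\<in>UNIV. (?G ** ?I) $ b $ l * ?L l)"
    by (subst sum.swap) (simp add: matrix_matrix_mult_def sum_distrib_right)
  also have "\<dots> = (\<Sum>l\<in>UNIV. if b = l then ?L l else 0)"
    by (intro sum.cong refl) (simp add: gram_inverse[OF R p] mat_def)
  also have "\<dots> = ?L b" by simp
  finally show ?thesis .
qed

lemma metric_christoffel_form:
  assumes R: "riemannian_manifold M" and p: "p \<in> pts M"
  shows "metric M p (christoffel_form M (chart_at M p) p u v) w =
    (\<Sum>l\<in>UNIV. \<Sum>i\<in>UNIV. \<Sum>j\<in>UNIV.
       christoffel1 M (chart_at M p) (snd (chart_at M p) p) j l i * (u $ l * v $ i * w $ j))"
proof -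
  let ?x = "snd (chart_at M p) p"
  let ?G = "gram M (chart_at M p) ?x" and ?C = "christoffel M (chart_at M p) ?x"
  have "metric M p (christoffel_form M (chart_at M p) p u v) w =
    (\<Sum>k\<in>UNIV. \<Sum>j\<in>UNIV. \<Sum>l\<in>UNIV. \<Sum>i\<in>UNIV. ?G $ k $ j * ?C k l i * (u $ l * v $ i * w $ j))"
    by (simp add: metric_expand[OF R p] christoffel_form_def sum_distrib_left sum_distrib_right mult_ac)
  also have "\<dots> = (\<Sum>j\<in>UNIV. \<Sum>k\<in>UNIV. \<Sum>l\<in>UNIV. \<Sum>i\<in>UNIV. ?G $ k $ j * ?C k l i * (u $ l * v $ i * w $ j))"
    by (rule sum.swap)
  also have "\<dots> = (\<Sum>j\<in>UNIV. \<Sum>l\<in>UNIV. \<Sum>k\<in>UNIV. \<Sum>i\<in>UNIV. ?G $ k $ j * ?C k l i * (u $ l * v $ i * w $ j))"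
    by (intro sum.cong refl sum.swap)
  also have "\<dots> = (\<Sum>j\<in>UNIV. \<Sum>l\<in>UNIV. \<Sum>i\<in>UNIV. \<Sum>k\<in>UNIV. ?G $ k $ j * ?C k l i * (u $ l * v $ i * w $ j))"
    by (intro sum.cong refl sum.swap)
  also have "\<dots> = (\<Sum>j\<in>UNIV. \<Sum>l\<in>UNIV. \<Sum>i\<in>UNIV. christoffel1 M (chart_at M p) ?x j l i * (u $ l * v $ i * w $ j))"
    by (simp add: gram_christoffel[OF R p, symmetric] sum_distrib_right)
  also have "\<dots> = (\<Sum>l\<in>UNIV. \<Sum>j\<in>UNIV. \<Sum>i\<in>UNIV. christoffel1 M (chart_at M p) ?x j l i * (u $ l * v $ i * w $ j))"
    by (rule sum.swap)
  also have "\<dots> = (\<Sum>l\<in>UNIV. \<Sum>i\<in>UNIV. \<Sum>j\<in>UNIV. christoffel1 M (chart_at M p) ?x j l i * (u $ l * v $ i * w $ j))"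
    by (intro sum.cong refl sum.swap)
  finally show ?thesis .
qed

lemma levi_civita_metric:
  assumes R: "riemannian_manifold M" and p: "p \<in> pts M"
  shows "nabla2 M (metric M) p u v w = 0"
proof -
  let ?c = "chart_at M p" and ?x = "snd (chart_at M p) p"
  let ?g = "\<lambda>i j y. gram M ?c y $ i $ j"
  let ?h = "(\<lambda>q. metric M q (extend M p v q) (extend M p w q)) \<circ> cinv ?c"
  have M: "smooth_manifold M" using R by (simp add: riemannian_manifold_def)
  note c = chart_at[OF M p]
  have x: "?x \<in> crange ?c" using c by (simp add: crange_def)
  have d: "(?g i j has_derivative frechet_derivative (?g i j) (at ?x)) (at ?x)" for i j
    using gram_entry_differentiable[OF R c(1) x] by (simp add: frechet_derivative_works)
  have du: "frechet_derivative (?g i j) (at ?x) u = (\<Sum>l\<in>UNIV. partial l (?g i j) ?x * u $ l)" for i j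
  proof -
    have lin: "linear (frechet_derivative (?g i j) (at ?x))"
      using d has_derivative_linear by blast
    have "u = (\<Sum>l\<in>UNIV. u $ l *\<^sub>R axis l 1)"
      using basis_expansion[of u] by (simp add: scalar_mult_eq_scaleR)
    then have "frechet_derivative (?g i j) (at ?x) u =
        frechet_derivative (?g i j) (at ?x) (\<Sum>l\<in>UNIV. u $ l *\<^sub>R axis l 1)" by simp
    then show ?thesis
      by (simp add: linear_sum[OF lin] linear_cmul[OF lin] partial_def mult_ac)
  qed
  have "((\<lambda>y. \<Sum>i\<in>UNIV. \<Sum>j\<in>UNIV. ?g i j y * v $ i * w $ j) has_derivative
     (\<lambda>z. \<Sum>i\<in>UNIV. \<Sum>j\<in>UNIV. frechet_derivative (?g i j) (at ?x) z * v $ i * w $ j)) (at ?x)"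
    by (intro has_derivative_sum has_derivative_mult_left d)
  then have "(?h has_derivative
     (\<lambda>z. \<Sum>i\<in>UNIV. \<Sum>j\<in>UNIV. frechet_derivative (?g i j) (at ?x) z * v $ i * w $ j)) (at ?x)"
    by (rule has_derivative_transform_within_open[OF _ crange_open[OF M c(1)] x])
       (simp add: extend_def gram_expand[OF R c(1)])
  from frechet_derivative_at[OF this]
  have "dfun M (\<lambda>q. metric M q (extend M p v q) (extend M p w q)) p u =
     (\<Sum>i\<in>UNIV. \<Sum>j\<in>UNIV. frechet_derivative (?g i j) (at ?x) u * v $ i * w $ j)"
    unfolding dfun_def by (rule fun_cong[OF sym])
  also have "\<dots> = (\<Sum>i\<in>UNIV. \<Sum>j\<in>UNIV. \<Sum>l\<in>UNIV. partial l (?g i j) ?x * (u $ l * v $ i * w $ j))"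
    by (simp add: du sum_distrib_left mult_ac)
  also have "\<dots> = (\<Sum>i\<in>UNIV. \<Sum>l\<in>UNIV. \<Sum>j\<in>UNIV. partial l (?g i j) ?x * (u $ l * v $ i * w $ j))"
    by (intro sum.cong refl sum.swap)
  also have "\<dots> = (\<Sum>l\<in>UNIV. \<Sum>i\<in>UNIV. \<Sum>j\<in>UNIV. partial l (?g i j) ?x * (u $ l * v $ i * w $ j))"
    by (rule sum.swap)
  finally have 1: "dfun M (\<lambda>q. metric M q (extend M p v q) (extend M p w q)) p u =
     (\<Sum>l\<in>UNIV. \<Sum>i\<in>UNIV. \<Sum>j\<in>UNIV. partial l (?g i j) ?x * (u $ l * v $ i * w $ j))" .
  have sym: "metric M p v y = metric M p y v" for y
    using R p by (simp add: riemannian_manifold_def)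
  have "metric M p v (christoffel_form M ?c p u w) =
     (\<Sum>l\<in>UNIV. \<Sum>i\<in>UNIV. \<Sum>j\<in>UNIV. christoffel1 M ?c ?x j l i * (u $ l * w $ i * v $ j))"
    by (subst sym) (rule metric_christoffel_form[OF R p])
  also have "\<dots> = (\<Sum>l\<in>UNIV. \<Sum>j\<in>UNIV. \<Sum>i\<in>UNIV. christoffel1 M ?c ?x j l i * (u $ l * w $ i * v $ j))"
    by (intro sum.cong refl sum.swap)
  finally have 2: "metric M p v (christoffel_form M ?c p u w) =
     (\<Sum>l\<in>UNIV. \<Sum>i\<in>UNIV. \<Sum>j\<in>UNIV. christoffel1 M ?c ?x i l j * (u $ l * v $ i * w $ j))"
    by (simp add: mult_ac)
  have L: "partial l (?g i j) ?x = christoffel1 M ?c ?x j l i + christoffel1 M ?c ?x i l j" for l i j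
    unfolding christoffel1_def partial_gram_symmetric[OF R c(1) x, of _ j i] by (simp add: field_simps)
  show ?thesis
    unfolding nabla2_def Let_def levi_civita_extend[OF M p] 1 2 metric_christoffel_form[OF R p] L
    by (simp add: distrib_right sum.distrib)
qed

lemma ex_ortho_basis:
  fixes M :: "('a, 'n::finite) rmanifold"
  assumes R: "riemannian_manifold M" and p: "p \<in> pts M"
  shows "\<exists>e. ortho_basis M p e"
proof -
  let ?g = "metric M p"
  have bil: "bilinear ?g" and sym: "\<And>u v. ?g u v = ?g v u" and pos: "\<And>v. v \<noteq> 0 \<Longrightarrow> ?g v v > 0"
    using R p by (auto simp: riemannian_manifold_def)
  have lin: "linear (?g u)" for u using bil by (simp add: bilinear_def)
  have "\<exists>e. \<forall>i\<in>S. \<forall>j\<in>S. ?g (e i) (e j) = (if i = j then 1 else 0)" for S :: "'n set"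
  using finite[of S]
  proof (induction S rule: finite_induct)
    case empty then show ?case by simp
  next
    case (insert a S)
    then obtain e where e: "\<And>i j. i \<in> S \<Longrightarrow> j \<in> S \<Longrightarrow> ?g (e i) (e j) = (if i = j then 1 else 0)"
      by blast
    have "card (e ` S) < CARD('n)"
      using insert.hyps by (intro order.strict_trans1[OF card_image_le psubset_card_mono]) auto
    then have "dim (e ` S) < DIM(real ^ 'n)"
      using dim_le_card'[of "e ` S"] by simp
    then have "span (e ` S) \<noteq> UNIV" using dim_span[of "e ` S"] by (metis dim_UNIV less_irrefl)
    then obtain y where y: "y \<notin> span (e ` S)" by blast
    define z where "z = y - (\<Sum>i\<in>S. ?g (e i) y *\<^sub>R e i)"
    have "(\<Sum>i\<in>S. ?g (e i) y *\<^sub>R e i) \<in> span (e ` S)"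
      by (intro span_sum span_scale span_base) auto
    then have "z \<noteq> 0" using y by (auto simp: z_def)
    have z0: "?g (e j) z = 0" if "j \<in> S" for j
    proof -
      have "?g (e j) z = ?g (e j) y - (\<Sum>i\<in>S. ?g (e i) y * ?g (e j) (e i))"
        by (simp add: z_def linear_diff[OF lin] linear_sum[OF lin] linear_cmul[OF lin])
      also have "(\<Sum>i\<in>S. ?g (e i) y * ?g (e j) (e i)) = (\<Sum>i\<in>S. if j = i then ?g (e i) y else 0)"
        by (intro sum.cong refl) (simp add: e that)
      finally show ?thesis using that by simp
    qed
    define w where "w = (1 / sqrt (?g z z)) *\<^sub>R z"
    have ww: "?g w w = 1"
      using pos[OF \<open>z \<noteq> 0\<close>] by (simp add: w_def bilinear_lmul[OF bil] bilinear_rmul[OF bil])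
    have w0: "?g (e j) w = 0" "?g w (e j) = 0" if "j \<in> S" for j
      using z0[OF that] sym[of w] by (simp_all add: w_def bilinear_rmul[OF bil])
    show ?case
      using insert.hyps(2) by (intro exI[of _ "e(a := w)"]) (auto simp: e ww w0)
  qed
  from this[of UNIV] show ?thesis unfolding ortho_basis_def by simp
qed

end

theory Submission
  imports Defs
begin

text \<open>
Both directions are pointwise and rest on one identity, valid for every smooth map
(\<open>divergence_pullback_metric\<close>):
\<open>\<delta>g\<^sup>* = - \<langle>\<tau>(f), f\<^sub>* \<cdot>\<rangle> - 1/2 d e(f)\<close>.
Hence \<open>\<delta>g\<^sup>* = - 1/2 d e(f)\<close> says exactly that the tension field is orthogonal to the
image of the differential at every point. A vanishing tension field satisfies this trivially. If the
differential is onto everywhere, as it is for a submersion by definition and for a diffeomorphism by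
the chain rule (\<open>surj_differential_diffeomorphism\<close>), the tension field is orthogonal to itself
and vanishes.

The identity combines three facts about the second fundamental form \<open>D f\<^sub>*\<close>. The pullback metric
obeys the Leibniz rule
\<open>(\<nabla>\<^sub>u g\<^sup>*)(v, w) = \<langle>(D f\<^sub>*)(u, v), f\<^sub>*w\<rangle> + \<langle>f\<^sub>*v, (D f\<^sub>*)(u, w)\<rangle>\<close> (\<open>nabla2_pullback_metric\<close>),
because both connections are metric; \<open>D f\<^sub>*\<close> is symmetric (\<open>D_differential_symmetric\<close>), because both
are torsion-free and second derivatives of coordinate functions commute
(\<open>symmetric_second_derivative\<close>); and the trace commutes with covariant differentiation
(\<open>dfun_trace_g\<close>), so that \<open>d e(f)\<close> is the trace of \<open>\<nabla>g\<^sup>*\<close>. Tracing the Leibniz rule in the two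
possible ways and comparing gives the identity.

Two points need care. The trace at each point is taken in an arbitrarily chosen orthonormal basis,
with no regularity from point to point; it is therefore rewritten in a frame of constant coordinates with the
inverse Gram matrix (\<open>trace_g_frame\<close>) before it is differentiated. Likewise tangent vectors are
represented in a chart chosen separately at each point, so the differential is first transported to
a fixed pair of charts (\<open>differential_tan_vec\<close>).
\<close>

section \<open>Symmetry of second derivatives\<close>

text \<open>
The classical route to the symmetry of second derivatives: the mixed difference over the
parallelogram spanned by \<open>t u\<close> and \<open>t v\<close> is symmetric in \<open>u\<close> and \<open>v\<close>, and the mean value theorem,
applied along \<open>u\<close> and then along \<open>v\<close>, turns it into \<open>t\<^sup>2\<close> times a mixed second derivative at
a nearby point.
\<close>

lemma mixed_difference_mvt:
  fixes f :: "'a::real_normed_vector \<Rightarrow> real"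
  assumes t: "t > 0" "t * (norm u + norm v) < r"
    and f: "\<And>y. y \<in> ball x r \<Longrightarrow> f differentiable (at y)"
    and g: "\<And>y. y \<in> ball x r \<Longrightarrow> (\<lambda>z. frechet_derivative f (at z) u) differentiable (at y)"
  shows "\<exists>z. dist x z \<le> t * (norm u + norm v) \<and>
     f (x + t *\<^sub>R u + t *\<^sub>R v) - f (x + t *\<^sub>R u) - f (x + t *\<^sub>R v) + f x
       = t * t * frechet_derivative (\<lambda>y. frechet_derivative f (at y) u) (at z) v"
proof -
  have near: "dist x (x + a *\<^sub>R u + b *\<^sub>R v) \<le> t * (norm u + norm v)"
    if "0 \<le> a" "a \<le> t" "0 \<le> b" "b \<le> t" for a b
  proof -
    have "norm (a *\<^sub>R u + b *\<^sub>R v) \<le> a * norm u + b * norm v"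
      using norm_triangle_ineq[of "a *\<^sub>R u" "b *\<^sub>R v"] that by simp
    also have "\<dots> \<le> t * norm u + t * norm v"
      using that by (intro add_mono mult_right_mono) auto
    finally show ?thesis by (simp add: dist_norm algebra_simps norm_minus_commute)
  qed
  have inb: "x + a *\<^sub>R u + b *\<^sub>R v \<in> ball x r"
    if "0 \<le> a" "a \<le> t" "0 \<le> b" "b \<le> t" for a b
    using near[OF that] t(2) by simp
  let ?g = "\<lambda>y. frechet_derivative f (at y) u"
  have df: "((\<lambda>a. f (x + a *\<^sub>R u + b *\<^sub>R v)) has_derivative (\<lambda>h. h * ?g (x + a *\<^sub>R u + b *\<^sub>R v))) (at a)"
    if "0 \<le> a" "a \<le> t" "0 \<le> b" "b \<le> t" for a b
  proof -
    let ?y = "x + a *\<^sub>R u + b *\<^sub>R v"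
    have d: "(f has_derivative frechet_derivative f (at ?y)) (at ?y)"
      using f[OF inb[OF that]] by (simp add: frechet_derivative_works)
    have "((\<lambda>a. x + a *\<^sub>R u + b *\<^sub>R v) has_derivative (\<lambda>h. h *\<^sub>R u)) (at a)"
      by (auto intro!: derivative_eq_intros)
    from has_derivative_compose[OF this d] show ?thesis
      by (simp add: linear_cmul[OF has_derivative_linear[OF d]])
  qed
  have "\<exists>a\<in>{0<..<t}. (f (x + t *\<^sub>R u + t *\<^sub>R v) - f (x + t *\<^sub>R u + 0 *\<^sub>R v))
      - (f (x + 0 *\<^sub>R u + t *\<^sub>R v) - f (x + 0 *\<^sub>R u + 0 *\<^sub>R v))
      = (t - 0) * ?g (x + a *\<^sub>R u + t *\<^sub>R v) - (t - 0) * ?g (x + a *\<^sub>R u + 0 *\<^sub>R v)"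
  proof (rule mvt_simple[where f = "\<lambda>a. f (x + a *\<^sub>R u + t *\<^sub>R v) - f (x + a *\<^sub>R u + 0 *\<^sub>R v)"
        and f' = "\<lambda>a h. h * ?g (x + a *\<^sub>R u + t *\<^sub>R v) - h * ?g (x + a *\<^sub>R u + 0 *\<^sub>R v)"])
    show "((\<lambda>a. f (x + a *\<^sub>R u + t *\<^sub>R v) - f (x + a *\<^sub>R u + 0 *\<^sub>R v)) has_derivative
        (\<lambda>h. h * ?g (x + a *\<^sub>R u + t *\<^sub>R v) - h * ?g (x + a *\<^sub>R u + 0 *\<^sub>R v)))
        (at a within {0..t})" if "0 \<le> a" "a \<le> t" for a
      by (rule has_derivative_at_withinI, rule has_derivative_diff[OF df df]) (use that t(1) in simp_all)
  qed (rule t(1))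
  then obtain a where a: "0 < a" "a < t"
    and 1: "f (x + t *\<^sub>R u + t *\<^sub>R v) - f (x + t *\<^sub>R u) - f (x + t *\<^sub>R v) + f x
      = t * (?g (x + a *\<^sub>R u + t *\<^sub>R v) - ?g (x + a *\<^sub>R u))"
    by (auto simp: algebra_simps)
  have dg: "((\<lambda>b. ?g (x + a *\<^sub>R u + b *\<^sub>R v)) has_derivative
      (\<lambda>h. h * frechet_derivative ?g (at (x + a *\<^sub>R u + b *\<^sub>R v)) v)) (at b)"
    if "0 \<le> b" "b \<le> t" for b
  proof -
    let ?y = "x + a *\<^sub>R u + b *\<^sub>R v"
    have "?y \<in> ball x r" using a that by (intro inb) auto
    then have d: "(?g has_derivative frechet_derivative ?g (at ?y)) (at ?y)"
      using g by (simp add: frechet_derivative_works[symmetric])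
    have "((\<lambda>b. x + a *\<^sub>R u + b *\<^sub>R v) has_derivative (\<lambda>h. h *\<^sub>R v)) (at b)"
      by (auto intro!: derivative_eq_intros)
    from has_derivative_compose[OF this d] show ?thesis
      by (simp add: linear_cmul[OF has_derivative_linear[OF d]])
  qed
  have "\<exists>b\<in>{0<..<t}. ?g (x + a *\<^sub>R u + t *\<^sub>R v) - ?g (x + a *\<^sub>R u + 0 *\<^sub>R v)
      = (t - 0) * frechet_derivative ?g (at (x + a *\<^sub>R u + b *\<^sub>R v)) v"
  proof (rule mvt_simple[where f = "\<lambda>b. ?g (x + a *\<^sub>R u + b *\<^sub>R v)"
        and f' = "\<lambda>b h. h * frechet_derivative ?g (at (x + a *\<^sub>R u + b *\<^sub>R v)) v"])
    show "((\<lambda>b. ?g (x + a *\<^sub>R u + b *\<^sub>R v)) has_derivative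
        (\<lambda>h. h * frechet_derivative ?g (at (x + a *\<^sub>R u + b *\<^sub>R v)) v)) (at b within {0..t})"
      if "0 \<le> b" "b \<le> t" for b
      using has_derivative_at_withinI[OF dg[OF that]] .
  qed (rule t(1))
  then obtain b where b: "0 < b" "b < t"
    and 2: "?g (x + a *\<^sub>R u + t *\<^sub>R v) - ?g (x + a *\<^sub>R u)
      = t * frechet_derivative ?g (at (x + a *\<^sub>R u + b *\<^sub>R v)) v"
    by auto
  show ?thesis
    using near[of a b] a b unfolding 1 2 by (intro exI[of _ "x + a *\<^sub>R u + b *\<^sub>R v"]) auto
qed

text \<open>
The two mixed derivatives agree at points within \<open>t (norm u + norm v)\<close> of \<open>x\<close>, hence by continuity
they agree at \<open>x\<close>.
\<close>

lemma symmetric_second_derivative_real: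
  fixes f :: "'a::real_normed_vector \<Rightarrow> real"
  assumes "open S" "x \<in> S" and C2: "Ck_on (Suc (Suc 0)) S f"
  shows "frechet_derivative (\<lambda>y. frechet_derivative f (at y) v) (at x) u
       = frechet_derivative (\<lambda>y. frechet_derivative f (at y) u) (at x) v"
proof -
  let ?A = "\<lambda>u v z. frechet_derivative (\<lambda>y. frechet_derivative f (at y) u) (at z) v"
  obtain r where r: "r > 0" "ball x r \<subseteq> S" using assms(1,2) by (meson open_contains_ball)
  have cont: "isCont (?A a b) x" for a b
    using C2 assms(1,2) by (auto simp: continuous_on_eq_continuous_at)
  have "\<bar>?A v u x - ?A u v x\<bar> < e" if "e > 0" for e
  proof -
    obtain d1 where d1: "d1 > 0" "\<And>z. dist z x < d1 \<Longrightarrow> dist (?A u v z) (?A u v x) < e/2"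
      using cont[of u v] \<open>e > 0\<close> unfolding continuous_at_eps_delta by (metis half_gt_zero)
    obtain d2 where d2: "d2 > 0" "\<And>z. dist z x < d2 \<Longrightarrow> dist (?A v u z) (?A v u x) < e/2"
      using cont[of v u] \<open>e > 0\<close> unfolding continuous_at_eps_delta by (metis half_gt_zero)
    \<comment> \<open>The summand 1 keeps the bound on the size of the parallelogram positive even when \<open>u = v = 0\<close>.\<close>
    define n where "n = norm u + norm v + 1"
    define t where "t = min r (min d1 d2) / n"
    have n: "n > 0" unfolding n_def by (simp add: add_nonneg_pos)
    have t: "t > 0" using r d1 d2 n by (simp add: t_def)
    have "t * (norm u + norm v) < t * n" using t by (simp add: n_def)
    then have tn: "t * (norm u + norm v) < min r (min d1 d2)" using n by (simp add: t_def)
    have diff: "f differentiable at y" "(\<lambda>z. frechet_derivative f (at z) a) differentiable (at y)"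
      if "y \<in> ball x r" for y a using C2 r that by auto
    obtain z where z: "dist x z \<le> t * (norm u + norm v)"
       "f (x + t *\<^sub>R u + t *\<^sub>R v) - f (x + t *\<^sub>R u) - f (x + t *\<^sub>R v) + f x = t * t * ?A u v z"
      using mixed_difference_mvt[of t u v r x f] t tn diff by auto
    obtain z' where z': "dist x z' \<le> t * (norm v + norm u)"
       "f (x + t *\<^sub>R v + t *\<^sub>R u) - f (x + t *\<^sub>R v) - f (x + t *\<^sub>R u) + f x = t * t * ?A v u z'"
      using mixed_difference_mvt[of t v u r x f] t tn diff by (auto simp: add.commute)
    have "t * t * ?A u v z = t * t * ?A v u z'"
      unfolding z(2)[symmetric] z'(2)[symmetric] by (simp add: algebra_simps)
    then have "?A u v z = ?A v u z'" using t by simp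
    moreover have "dist z x < d1" "dist z' x < d2"
      using z(1) z'(1) tn by (simp_all add: dist_commute add.commute)
    then have "dist (?A u v z) (?A u v x) < e/2" "dist (?A v u z') (?A v u x) < e/2"
      using d1(2) d2(2) by blast+
    ultimately show ?thesis unfolding dist_real_def by linarith
  qed
  from this[of "\<bar>?A v u x - ?A u v x\<bar>"] show ?thesis by (cases "?A v u x = ?A u v x") simp_all
qed

lemma frechet_derivative_inner:
  fixes f :: "'a::real_normed_vector \<Rightarrow> 'b::real_inner"
  assumes "f differentiable (at x)"
  shows "(\<lambda>y. f y \<bullet> b) differentiable (at x)"
    and "frechet_derivative (\<lambda>y. f y \<bullet> b) (at x) u = frechet_derivative f (at x) u \<bullet> b"
proof -
  have d: "((\<lambda>y. f y \<bullet> b) has_derivative (\<lambda>h. frechet_derivative f (at x) h \<bullet> b)) (at x)"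
    using assms by (intro has_derivative_inner_left) (simp add: frechet_derivative_works)
  then show "(\<lambda>y. f y \<bullet> b) differentiable (at x)" unfolding differentiable_def by blast
  show "frechet_derivative (\<lambda>y. f y \<bullet> b) (at x) u = frechet_derivative f (at x) u \<bullet> b"
    using frechet_derivative_at[OF d] by metis
qed

text \<open>
Higher differentiability involves derivatives at points, so equality on an \<^emph>\<open>open\<close> set is needed.
\<close>

lemma Ck_on_cong:
  assumes "open S" "\<And>x. x \<in> S \<Longrightarrow> f x = g x" "Ck_on k S f"
  shows "Ck_on k S g"
  using assms(2,3)
proof (induction k arbitrary: f g)
  case 0 then show ?case by (simp add: continuous_on_eq)
next
  case (Suc k)
  have d: "(g has_derivative frechet_derivative f (at x)) (at x)" if "x \<in> S" for x
  proof (rule has_derivative_transform_within_open[OF _ assms(1) that])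
    show "(f has_derivative frechet_derivative f (at x)) (at x)"
      using Suc.prems(2) that by (simp add: frechet_derivative_works)
  qed (rule Suc.prems(1))
  have "Ck_on k S (\<lambda>x. frechet_derivative g (at x) v)" for v
    by (rule Suc.IH[of "\<lambda>x. frechet_derivative f (at x) v"])
       (use Suc.prems(2) frechet_derivative_at[OF d] in auto)
  then show ?case using d unfolding Ck_on.simps differentiable_def by blast
qed

lemma Ck_on_inner:
  fixes f :: "'a::real_normed_vector \<Rightarrow> 'b::real_inner"
  assumes "open S" "Ck_on k S f"
  shows "Ck_on k S (\<lambda>x. f x \<bullet> b)"
  using assms(2)
proof (induction k arbitrary: f)
  case 0 then show ?case by (auto intro: continuous_intros)
next
  case (Suc k)
  then have "Ck_on k S (\<lambda>x. frechet_derivative f (at x) v \<bullet> b)" for v by simp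
  then have "Ck_on k S (\<lambda>x. frechet_derivative (\<lambda>y. f y \<bullet> b) (at x) v)" for v
    by (rule Ck_on_cong[OF assms(1), rotated])
       (use Suc.prems in \<open>simp add: frechet_derivative_inner\<close>)
  then show ?case using Suc.prems by (simp add: frechet_derivative_inner)
qed

text \<open>
Schwarz's theorem for vector-valued maps follows by testing against every vector \<open>b\<close>. In the
sequel it makes the second fundamental form \<open>D f\<^sub>*\<close> symmetric.
\<close>

theorem symmetric_second_derivative:
  fixes f :: "'a::real_normed_vector \<Rightarrow> 'b::real_inner"
  assumes S: "open S" "x \<in> S" and C2: "Ck_on (Suc (Suc 0)) S f"
  shows "frechet_derivative (\<lambda>y. frechet_derivative f (at y) v) (at x) u
       = frechet_derivative (\<lambda>y. frechet_derivative f (at y) u) (at x) v"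
proof -
  have comp: "frechet_derivative (\<lambda>y. frechet_derivative (\<lambda>y. f y \<bullet> b) (at y) v) (at x) u
      = frechet_derivative (\<lambda>y. frechet_derivative f (at y) v) (at x) u \<bullet> b" for b u v
  proof -
    have d: "((\<lambda>y. frechet_derivative f (at y) v \<bullet> b) has_derivative
        (\<lambda>h. frechet_derivative (\<lambda>y. frechet_derivative f (at y) v) (at x) h \<bullet> b)) (at x)"
      using C2 S(2) by (intro has_derivative_inner_left) (simp add: frechet_derivative_works[symmetric])
    have "((\<lambda>y. frechet_derivative (\<lambda>y. f y \<bullet> b) (at y) v) has_derivative
        (\<lambda>h. frechet_derivative (\<lambda>y. frechet_derivative f (at y) v) (at x) h \<bullet> b)) (at x)"
      by (rule has_derivative_transform_within_open[OF d S])
         (use C2 in \<open>simp add: frechet_derivative_inner\<close>)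
    from frechet_derivative_at[OF this] show ?thesis by metis
  qed
  have "(frechet_derivative (\<lambda>y. frechet_derivative f (at y) v) (at x) u
       - frechet_derivative (\<lambda>y. frechet_derivative f (at y) u) (at x) v) \<bullet> b = 0" for b
    using symmetric_second_derivative_real[OF S Ck_on_inner[OF S(1) C2, of b]]
    unfolding comp inner_diff_left by simp
  then show ?thesis by (metis eq_iff_diff_eq_0 inner_eq_zero_iff)
qed

section \<open>Differentiating a trace with respect to a varying inner product\<close>

lemma differentiable_det:
  fixes A :: "'a::real_normed_vector \<Rightarrow> real ^ 'n ^ 'n"
  assumes "\<And>i j. (\<lambda>x. A x $ i $ j) differentiable (at x)"
  shows "(\<lambda>x. det (A x)) differentiable (at x)"
proof -
  have "(\<lambda>x. \<Prod>i\<in>UNIV. A x $ i $ \<pi> i) differentiable (at x)" for \<pi>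
    by (rule differentiableI, rule has_derivative_prod)
       (rule assms[unfolded frechet_derivative_works])
  then show ?thesis unfolding det_def by (intro differentiable_sum differentiable_mult) auto
qed

text \<open>
By Cramer's rule the entries of the inverse are quotients of determinants. This gives a local
right inverse whose entries are differentiable at the point.
\<close>

lemma differentiable_matrix_inverse:
  fixes A :: "'a::real_normed_vector \<Rightarrow> real ^ 'n ^ 'n"
  assumes A: "\<And>i j. (\<lambda>y. A y $ i $ j) differentiable (at x)" and det: "det (A x) \<noteq> 0"
  shows "\<exists>S (B :: 'a \<Rightarrow> real ^ 'n ^ 'n). open S \<and> x \<in> S \<and> (\<forall>y\<in>S. A y ** B y = mat 1) \<and>
    (\<forall>i j. (\<lambda>y. B y $ i $ j) differentiable (at x))"
proof -
  have dd: "(\<lambda>x. det (A x)) differentiable (at x)" by (rule differentiable_det[OF A])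
  then have "isCont (\<lambda>x. det (A x)) x" by (rule differentiable_imp_continuous_within)
  then obtain e where e: "e > 0" "\<And>y. dist x y < e \<Longrightarrow> det (A y) \<noteq> 0"
    using continuous_at_avoid det by blast
  define B where "B y = (\<chi> k j. det (\<chi> i l. if l = k then (axis j 1) $ i else A y $ i $ l) / det (A y))" for y
  have AB: "A y ** B y = mat 1" if "y \<in> ball x e" for y
  proof -
    have "det (A y) \<noteq> 0" using e(2) that by simp
    then have col: "A y *v (\<chi> k. B y $ k $ j) = axis j 1" for j
      by (subst cramer) (simp_all add: B_def)
    have "(A y ** B y) $ i $ j = (A y *v (\<chi> k. B y $ k $ j)) $ i" for i j
      by (simp add: matrix_matrix_mult_def matrix_vector_mult_def)
    then show ?thesis unfolding col by (simp add: vec_eq_iff mat_def axis_def)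
  qed
  have "(\<lambda>y. B y $ k $ j) differentiable (at x)" for k j
  proof -
    have "(\<lambda>y. det (\<chi> i l. if l = k then (axis j 1) $ i else A y $ i $ l)) differentiable (at x)"
    proof (rule differentiable_det)
      fix i l
      show "(\<lambda>y. (\<chi> i l. if l = k then (axis j 1) $ i else A y $ i $ l) $ i $ l) differentiable (at x)"
        using A[of i l] by (cases "l = k") simp_all
    qed
    then show ?thesis
      unfolding B_def using dd det by (simp add: differentiable_divide)
  qed
  then show ?thesis
    using AB e(1) by (intro exI[of _ "ball x e"] exI[of _ B]) simp
qed

text \<open>
The derivative of \<open>tr (\<Phi> P\<^sup>-\<^sup>1)\<close> at a point where \<open>P\<close> is the identity is
\<open>tr \<Phi>' - tr (\<Phi> P')\<close>. Here \<open>P\<close> stands for the Gram matrix of a moving frame that need be orthonormal at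
one point only and \<open>T\<close> for the trace of a tensor with components \<open>\<Phi>\<close>; the frame-independent trace
is thus differentiated although no differentiable choice of orthonormal frames is at hand.
\<close>

lemma has_derivative_trace_matrix_inverse:
  fixes P \<Phi> :: "'a::real_normed_vector \<Rightarrow> real ^ 'n ^ 'n"
  assumes P: "\<And>i j. ((\<lambda>y. P y $ i $ j) has_derivative P' i j) (at x)" and Px: "P x = mat 1"
    and \<Phi>: "\<And>i j. ((\<lambda>y. \<Phi> y $ i $ j) has_derivative \<Phi>' i j) (at x)"
    and W: "open W" "x \<in> W"
    and T: "\<And>y Q. y \<in> W \<Longrightarrow> P y ** Q = (mat 1 :: real ^ 'n ^ 'n) \<Longrightarrow> T y = trace (\<Phi> y ** Q)"
  shows "(T has_derivative (\<lambda>h. (\<Sum>i\<in>UNIV. \<Phi>' i i h) - (\<Sum>i\<in>UNIV. \<Sum>j\<in>UNIV. \<Phi> x $ i $ j * P' j i h)))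
           (at x)"
proof -
  have dP: "(\<lambda>y. P y $ i $ j) differentiable (at x)" for i j
    using P by (rule differentiableI)
  have "det (P x) \<noteq> 0" by (simp add: Px)
  from differentiable_matrix_inverse[where A = P, OF dP this]
  obtain S and Q :: "'a \<Rightarrow> real ^ 'n ^ 'n" where S: "open S" "x \<in> S"
    and PQ: "\<And>y. y \<in> S \<Longrightarrow> P y ** Q y = mat 1"
    and dQ: "\<And>i j. (\<lambda>y. Q y $ i $ j) differentiable (at x)"
    by blast
  have Qx: "Q x = mat 1" using PQ[OF S(2)] by (simp add: Px)
  define Q' where "Q' i j = frechet_derivative (\<lambda>y. Q y $ i $ j) (at x)" for i j
  have Q: "((\<lambda>y. Q y $ i $ j) has_derivative Q' i j) (at x)" for i j
    using dQ by (simp add: Q'_def frechet_derivative_works[symmetric])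
  \<comment> \<open>Differentiate \<open>P Q = 1\<close> at the point where \<open>P = Q = 1\<close>.\<close>
  have Q'_eq: "Q' i j h = - P' i j h" for i j h
  proof -
    have "((\<lambda>y. \<Sum>k\<in>UNIV. P y $ i $ k * Q y $ k $ j) has_derivative
        (\<lambda>h. \<Sum>k\<in>UNIV. P x $ i $ k * Q' k j h + P' i k h * Q x $ k $ j)) (at x)"
      by (intro has_derivative_sum has_derivative_mult P Q)
    moreover have "((\<lambda>y. \<Sum>k\<in>UNIV. P y $ i $ k * Q y $ k $ j) has_derivative (\<lambda>h. 0)) (at x)"
    proof (rule has_derivative_transform_within_open[OF _ S])
      show "((\<lambda>y. (mat 1 :: real ^ 'n ^ 'n) $ i $ j) has_derivative (\<lambda>h. 0)) (at x)" by simp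
      show "(mat 1 :: real ^ 'n ^ 'n) $ i $ j = (\<Sum>k\<in>UNIV. P y $ i $ k * Q y $ k $ j)" if "y \<in> S" for y
        unfolding PQ[OF that, symmetric] by (simp add: matrix_matrix_mult_def)
    qed
    ultimately have "(\<Sum>k\<in>UNIV. P x $ i $ k * Q' k j h + P' i k h * Q x $ k $ j) = 0"
      by (rule fun_cong[OF has_derivative_unique])
    moreover have "(\<Sum>k\<in>UNIV. P x $ i $ k * Q' k j h) = (\<Sum>k\<in>UNIV. if i = k then Q' k j h else 0)"
      by (intro sum.cong refl) (simp add: Px mat_def)
    moreover have "(\<Sum>k\<in>UNIV. P' i k h * Q x $ k $ j) = (\<Sum>k\<in>UNIV. if k = j then P' i k h else 0)"
      by (intro sum.cong refl) (simp add: Qx mat_def)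
    ultimately show ?thesis by (simp add: sum.distrib)
  qed
  have "((\<lambda>y. \<Sum>i\<in>UNIV. \<Sum>j\<in>UNIV. \<Phi> y $ i $ j * Q y $ j $ i) has_derivative
      (\<lambda>h. \<Sum>i\<in>UNIV. \<Sum>j\<in>UNIV. \<Phi> x $ i $ j * Q' j i h + \<Phi>' i j h * Q x $ j $ i)) (at x)"
    by (intro has_derivative_sum has_derivative_mult \<Phi> Q)
  also have "(\<lambda>h. \<Sum>i\<in>UNIV. \<Sum>j\<in>UNIV. \<Phi> x $ i $ j * Q' j i h + \<Phi>' i j h * Q x $ j $ i)
      = (\<lambda>h. (\<Sum>i\<in>UNIV. \<Phi>' i i h) - (\<Sum>i\<in>UNIV. \<Sum>j\<in>UNIV. \<Phi> x $ i $ j * P' j i h))"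
  proof
    fix h
    have "(\<Sum>j\<in>UNIV. \<Phi> x $ i $ j * Q' j i h + \<Phi>' i j h * Q x $ j $ i)
        = \<Phi>' i i h - (\<Sum>j\<in>UNIV. \<Phi> x $ i $ j * P' j i h)" for i
    proof -
      have "(\<Sum>j\<in>UNIV. \<Phi>' i j h * Q x $ j $ i) = (\<Sum>j\<in>UNIV. if j = i then \<Phi>' i j h else 0)"
        by (intro sum.cong refl) (simp add: Qx mat_def)
      then show ?thesis by (simp add: Q'_eq sum_subtractf)
    qed
    then show "(\<Sum>i\<in>UNIV. \<Sum>j\<in>UNIV. \<Phi> x $ i $ j * Q' j i h + \<Phi>' i j h * Q x $ j $ i)
      = (\<Sum>i\<in>UNIV. \<Phi>' i i h) - (\<Sum>i\<in>UNIV. \<Sum>j\<in>UNIV. \<Phi> x $ i $ j * P' j i h)"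
      by (simp add: sum_subtractf)
  qed
  finally show ?thesis
    by (rule has_derivative_transform_within_open[OF _ open_Int[OF S(1) W(1)]])
       (use S W in \<open>simp_all add: T[OF _ PQ] trace_def matrix_matrix_mult_def\<close>)
qed

section \<open>Traces in arbitrary frames\<close>

text \<open>
The map from coefficients to linear combinations of an orthonormal family is injective, because
the inner products with the family recover the coefficients; by equality of dimensions it is onto.
\<close>

lemma orthonormal_expansion:
  assumes R: "riemannian_manifold M" and p: "p \<in> pts M" and e: "ortho_basis M p e"
  shows "v = (\<Sum>i\<in>UNIV. metric M p v (e i) *\<^sub>R e i)"
proof -
  define T where "T c = (\<Sum>i\<in>UNIV. c $ i *\<^sub>R e i)" for c
  have bil: "bilinear (metric M p)" using R p by (simp add: riemannian_manifold_def)
  have lin: "linear (\<lambda>x. metric M p x y)" for y using bil by (simp add: bilinear_def)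
  have coeff: "metric M p (T c) (e j) = c $ j" for c j
  proof -
    have "metric M p (T c) (e j) = (\<Sum>i\<in>UNIV. c $ i * metric M p (e i) (e j))"
      by (simp add: T_def linear_sum[OF lin] linear_cmul[OF lin])
    also have "\<dots> = (\<Sum>i\<in>UNIV. if i = j then c $ i else 0)"
      using e by (intro sum.cong refl) (simp add: ortho_basis_def)
    finally show ?thesis by simp
  qed
  have T: "linear T"
  proof (rule linearI)
    show "T (b + c) = T b + T c" for b c by (simp add: T_def scaleR_left_distrib sum.distrib)
    show "T (a *\<^sub>R c) = a *\<^sub>R T c" for a c by (simp add: T_def scaleR_sum_right)
  qed
  have "c = 0" if "T c = 0" for c
    using coeff[of c] that by (simp add: vec_eq_iff linear_0[OF lin])
  then have "surj T"
    using linear_injective_imp_surjective[OF T] linear_injective_0[OF T] by blast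
  then obtain c where "v = T c" by blast
  then show ?thesis using coeff[of c] by (simp add: T_def)
qed

text \<open>
If \<open>B\<close> expresses the frame \<open>E\<close> in the orthonormal basis \<open>e\<close> and \<open>T\<close> is the matrix of \<open>\<phi>\<close> in \<open>e\<close>,
then the matrix of \<open>\<phi>\<close> in \<open>E\<close> is \<open>B T B\<^sup>t\<close> and the Gram matrix of \<open>E\<close> is \<open>B B\<^sup>t\<close>. The cyclic
invariance of the trace gives \<open>tr (B T B\<^sup>t (B B\<^sup>t)\<^sup>-\<^sup>1) = tr T\<close>.
\<close>

lemma trace_in_frame:
  fixes M :: "('a, 'n::finite) rmanifold" and E :: "'n \<Rightarrow> real ^ 'n"
  assumes R: "riemannian_manifold M" and p: "p \<in> pts M" and e: "ortho_basis M p e"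
    and \<phi>: "bilinear \<phi>"
    and Q: "(\<chi> i j. metric M p (E i) (E j)) ** Q = mat 1"
  shows "(\<Sum>k\<in>UNIV. \<phi> (e k) (e k)) = trace ((\<chi> i j. \<phi> (E i) (E j)) ** Q)"
proof -
  define B :: "real ^ 'n ^ 'n" where "B = (\<chi> i k. metric M p (E i) (e k))"
  have frame: "(\<chi> i j. \<psi> (E i) (E j)) = B ** (\<chi> k l. \<psi> (e k) (e l)) ** transpose B"
    if \<psi>: "bilinear \<psi>" for \<psi> :: "real ^ 'n \<Rightarrow> real ^ 'n \<Rightarrow> real"
  proof -
    have ex: "E i = (\<Sum>k\<in>UNIV. B $ i $ k *\<^sub>R e k)" for i
      using orthonormal_expansion[OF R p e, of "E i"] by (simp add: B_def)
    have "\<psi> (E i) (E j) = (\<Sum>k\<in>UNIV. \<Sum>l\<in>UNIV. B $ i $ k * \<psi> (e k) (e l) * B $ j $ l)" for i j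
    proof -
      have "\<psi> (E i) (E j) = (\<Sum>(k,l)\<in>UNIV\<times>UNIV. \<psi> (B $ i $ k *\<^sub>R e k) (B $ j $ l *\<^sub>R e l))"
        by (subst (1) ex, subst (1) ex) (rule bilinear_sum[OF \<psi>])
      then show ?thesis
        unfolding sum.cartesian_product[symmetric]
        by (simp add: bilinear_lmul[OF \<psi>] bilinear_rmul[OF \<psi>] mult_ac)
    qed
    also have "(\<Sum>k\<in>UNIV. \<Sum>l\<in>UNIV. B $ i $ k * \<psi> (e k) (e l) * B $ j $ l)
        = (B ** (\<chi> k l. \<psi> (e k) (e l)) ** transpose B) $ i $ j" for i j
      by (subst sum.swap) (simp add: matrix_matrix_mult_def transpose_def sum_distrib_right)
    finally show ?thesis by (simp add: vec_eq_iff)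
  qed
  have "bilinear (metric M p)" using R p by (simp add: riemannian_manifold_def)
  moreover have "(\<chi> k l. metric M p (e k) (e l)) = mat 1"
    using e by (simp add: ortho_basis_def mat_def)
  ultimately have "(\<chi> i j. metric M p (E i) (E j)) = B ** transpose B"
    using frame by simp
  then have "B ** (transpose B ** Q) = mat 1" using Q by (simp add: matrix_mul_assoc)
  then have 1: "(transpose B ** Q) ** B = mat 1" by (simp add: matrix_left_right_inverse)
  let ?T = "\<chi> k l. \<phi> (e k) (e l)"
  have "trace ((\<chi> i j. \<phi> (E i) (E j)) ** Q) = trace (B ** (?T ** (transpose B ** Q)))"
    by (simp add: frame[OF \<phi>] matrix_mul_assoc)
  also have "\<dots> = trace (?T ** ((transpose B ** Q) ** B))"
    by (subst trace_mul_sym) (simp add: matrix_mul_assoc)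
  also have "\<dots> = (\<Sum>k\<in>UNIV. \<phi> (e k) (e k))" by (simp add: 1 trace_def)
  finally show ?thesis by simp
qed

text \<open>
In particular the trace does not depend on the orthonormal basis that the Hilbert choice in its
definition picks, a basis which could jump from one point to the next.
\<close>

lemma trace_g_frame:
  fixes M :: "('a, 'n::finite) rmanifold" and E :: "'n \<Rightarrow> real ^ 'n"
  assumes "riemannian_manifold M" "p \<in> pts M" "bilinear \<phi>"
    and "(\<chi> i j. metric M p (E i) (E j)) ** Q = mat 1"
  shows "trace_g M p \<phi> = trace ((\<chi> i j. \<phi> (E i) (E j)) ** Q)"
  using trace_in_frame[OF assms(1,2) someI_ex[OF ex_ortho_basis[OF assms(1,2)]] assms(3,4)]
  by (simp add: trace_g_def Let_def)

section \<open>The differential in arbitrary charts\<close>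

text \<open>
Tangent vectors are represented through a chart chosen for each base point, and the choice may
jump from one point to the next. Both \<open>tan_vec\<close> and \<open>differential\<close> are derivatives of local
representatives (of the identity in the first case), so that one chain rule for
local representatives handles every change of charts.
\<close>

definition local_rep :: "('a, 'n::finite) chart \<Rightarrow> ('b, 'm::finite) chart \<Rightarrow> ('a \<Rightarrow> 'b) \<Rightarrow> real ^ 'n \<Rightarrow> real ^ 'm" where
  "local_rep c d f = snd d \<circ> f \<circ> cinv c"

lemma smooth_map_id: "smooth_manifold M \<Longrightarrow> smooth_map M M id"
  by (simp add: smooth_map_def smooth_manifold_def)

lemma tan_vec_local_rep: "tan_vec M c q = frechet_derivative (local_rep c (chart_at M q) id) (at (snd c q))"
  by (simp add: tan_vec_def local_rep_def fun_eq_iff)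

lemma differential_local_rep:
  "differential M N f q = frechet_derivative (local_rep (chart_at M q) (chart_at N (f q)) f) (at (snd (chart_at M q) q))"
  by (simp add: differential_def dfun_def local_rep_def fun_eq_iff)

lemma chart_image_open:
  assumes "smooth_manifold M" "c \<in> atlas M" "openin (mtop M) W"
  shows "open (snd c ` (fst c \<inter> W))"
proof -
  have h: "homeomorphic_map (subtopology (mtop M) (fst c)) (top_of_set (crange c)) (snd c)"
    and o: "open (crange c)"
    using assms unfolding smooth_manifold_def by blast+
  have "openin (subtopology (mtop M) (fst c)) (fst c \<inter> W)"
    using assms(3) by (metis inf_commute openin_subtopology_Int)
  then have "openin (top_of_set (crange c)) (snd c ` (fst c \<inter> W))"
    using h by (meson homeomorphic_imp_open_map open_map_def)
  then show ?thesis using o by (meson openin_open_trans)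
qed

lemma local_rep_domain_open:
  assumes M: "smooth_manifold M" and N: "smooth_manifold N" and f: "smooth_map M N f"
    and c: "c \<in> atlas M" and d: "d \<in> atlas N"
  shows "open (snd c ` (fst c \<inter> f -` fst d))"
proof -
  have "openin (mtop N) (fst d)" using N d unfolding smooth_manifold_def by blast
  then have "openin (mtop M) {q \<in> pts M. f q \<in> fst d}"
    using f unfolding smooth_map_def by (blast intro: openin_continuous_map_preimage)
  moreover have "fst c \<inter> f -` fst d = fst c \<inter> {q \<in> pts M. f q \<in> fst d}"
    using chart_subset[OF M c] by blast
  ultimately show ?thesis using chart_image_open[OF M c] by simp
qed

lemma local_rep_differentiable:
  assumes "smooth_map M N f" "c \<in> atlas M" "d \<in> atlas N" "q \<in> fst c" "f q \<in> fst d"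
  shows "local_rep c d f differentiable (at (snd c q))"
proof (rule smooth_on_imp_differentiable)
  show "smooth_on (snd c ` (fst c \<inter> f -` fst d)) (local_rep c d f)"
    using assms unfolding smooth_map_def local_rep_def by blast
  show "snd c q \<in> snd c ` (fst c \<inter> f -` fst d)" using assms(4,5) by blast
qed

lemma local_rep_chain:
  assumes M: "smooth_manifold M" and N: "smooth_manifold N"
    and f: "smooth_map M N f" and h: "smooth_map N L h"
    and c: "c \<in> atlas M" "q \<in> fst c" and d: "d \<in> atlas N" "f q \<in> fst d"
    and b: "b \<in> atlas L" "h (f q) \<in> fst b"
  shows "frechet_derivative (local_rep c b (h \<circ> f)) (at (snd c q))
       = frechet_derivative (local_rep d b h) (at (snd d (f q))) \<circ> frechet_derivative (local_rep c d f) (at (snd c q))"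
proof -
  let ?U = "snd c ` (fst c \<inter> f -` fst d)"
  have fq: "local_rep c d f (snd c q) = snd d (f q)"
    by (simp add: local_rep_def cinv_chart[OF M c])
  have dF: "(local_rep c d f has_derivative frechet_derivative (local_rep c d f) (at (snd c q))) (at (snd c q))"
    using local_rep_differentiable[OF f c(1) d(1) c(2) d(2)] by (simp add: frechet_derivative_works)
  have dH: "(local_rep d b h has_derivative frechet_derivative (local_rep d b h) (at (snd d (f q))))
      (at (local_rep c d f (snd c q)))"
    using local_rep_differentiable[OF h d(1) b(1) d(2) b(2)] by (simp add: fq frechet_derivative_works)
  have "(local_rep c b (h \<circ> f) has_derivative
      frechet_derivative (local_rep d b h) (at (snd d (f q))) \<circ> frechet_derivative (local_rep c d f) (at (snd c q)))
      (at (snd c q))"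
  proof (rule has_derivative_transform_within_open[OF diff_chain_at[OF dF dH]])
    show "open ?U" by (rule local_rep_domain_open[OF M N f c(1) d(1)])
    show "snd c q \<in> ?U" using c d by blast
    show "(local_rep d b h \<circ> local_rep c d f) x = local_rep c b (h \<circ> f) x" if "x \<in> ?U" for x
      using that by (auto simp: local_rep_def cinv_chart[OF M c(1)] cinv_chart[OF N d(1)])
  qed
  from frechet_derivative_at[OF this] show ?thesis by simp
qed

lemma smooth_map_in_pts: "smooth_map M N f \<Longrightarrow> q \<in> pts M \<Longrightarrow> f q \<in> pts N"
  by (auto simp: smooth_map_def continuous_map_def)

text \<open>
The differential, which is expressed in the chosen charts at \<open>q\<close> and \<open>f q\<close>, is transported to one
fixed pair of charts. Only in fixed charts can it be differentiated with respect to \<open>q\<close>.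
\<close>

lemma differential_tan_vec:
  assumes M: "smooth_manifold M" and N: "smooth_manifold N" and f: "smooth_map M N f"
    and c: "c \<in> atlas M" "q \<in> fst c" and d: "d \<in> atlas N" "f q \<in> fst d"
  shows "differential M N f q (tan_vec M c q v)
       = tan_vec N d (f q) (frechet_derivative (local_rep c d f) (at (snd c q)) v)"
proof -
  have q: "q \<in> pts M" using chart_subset[OF M c(1)] c(2) by blast
  have fq: "f q \<in> pts N" by (rule smooth_map_in_pts[OF f q])
  note c' = chart_at[OF M q] and d' = chart_at[OF N fq]
  have "differential M N f q \<circ> tan_vec M c q
      = frechet_derivative (local_rep c (chart_at N (f q)) (f \<circ> id)) (at (snd c q))"
    using local_rep_chain[OF M M smooth_map_id[OF M] f c c'(1) _ d'(1)] c' d'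
    by (simp add: differential_local_rep tan_vec_local_rep)
  also have "\<dots> = tan_vec N d (f q) \<circ> frechet_derivative (local_rep c d f) (at (snd c q))"
    using local_rep_chain[OF M N f smooth_map_id[OF N] c d d'(1)] d'
    by (simp add: tan_vec_local_rep)
  finally show ?thesis by (metis comp_apply)
qed

lemma linear_differential:
  assumes M: "smooth_manifold M" and N: "smooth_manifold N" and f: "smooth_map M N f" and q: "q \<in> pts M"
  shows "linear (differential M N f q)"
  unfolding differential_local_rep
  by (intro linear_frechet_derivative local_rep_differentiable[OF f] chart_at[OF M q]
        chart_at[OF N smooth_map_in_pts[OF f q]])

text \<open>
The chain rule for \<open>f \<circ> f\<^sup>-\<^sup>1\<close> shows that the differential of the inverse is a right inverse of
the differential of \<open>f\<close>.
\<close>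

lemma surj_differential_diffeomorphism:
  assumes M: "smooth_manifold M" and N: "smooth_manifold N" and f: "diffeomorphism M N f" and p: "p \<in> pts M"
  shows "surj (differential M N f p)"
proof -
  let ?h = "inv_into (pts M) f" and ?c = "chart_at M p" and ?d = "chart_at N (f p)"
  have bij: "bij_betw f (pts M) (pts N)" and sf: "smooth_map M N f" and sh: "smooth_map N M ?h"
    using f by (auto simp: diffeomorphism_def)
  have fp: "f p \<in> pts N" by (rule smooth_map_in_pts[OF sf p])
  note c = chart_at[OF M p] and d = chart_at[OF N fp]
  have hfp: "?h (f p) = p" using bij p by (simp add: bij_betw_inv_into_left)
  have "frechet_derivative (local_rep ?d ?d (f \<circ> ?h)) (at (snd ?d (f p)))
      = differential M N f p \<circ> frechet_derivative (local_rep ?d ?c ?h) (at (snd ?d (f p)))"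
    using local_rep_chain[OF N M sh sf d c(1) _ d(1)] c d
    by (simp add: hfp differential_local_rep)
  moreover have "(local_rep ?d ?d (f \<circ> ?h) has_derivative id) (at (snd ?d (f p)))"
  proof (rule has_derivative_transform_within_open)
    show "(id has_derivative id) (at (snd ?d (f p)))" by (rule has_derivative_id)
    show "open (crange ?d)" by (rule crange_open[OF N d(1)])
    show "snd ?d (f p) \<in> crange ?d" using d by (simp add: crange_def)
    fix x assume x: "x \<in> crange ?d"
    then have "cinv ?d x \<in> pts N" using cinv_in chart_subset[OF N d(1)] by blast
    then show "id x = local_rep ?d ?d (f \<circ> ?h) x"
      using cinv_in(2)[OF x] by (simp add: local_rep_def bij_betw_inv_into_right[OF bij])
  qed
  ultimately have "differential M N f p \<circ> frechet_derivative (local_rep ?d ?c ?h) (at (snd ?d (f p))) = id"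
    using frechet_derivative_at by metis
  from fun_cong[OF this] show ?thesis by (intro surjI) simp
qed

section \<open>Covariant derivatives at the centre of a chart\<close>

lemma extend_at_point: "smooth_manifold M \<Longrightarrow> p \<in> pts M \<Longrightarrow> extend M p w p = w"
  by (simp add: extend_def tan_vec_chart_at)

lemma christoffel_form_symmetric:
  assumes "riemannian_manifold M" "p \<in> pts M"
  shows "christoffel_form M (chart_at M p) p u w = christoffel_form M (chart_at M p) p w u"
  using levi_civita_torsion_free[OF assms, of w u] assms
  by (simp add: levi_civita_extend riemannian_manifold_def)

text \<open>
Metric compatibility of the Levi-Civita connection, read as a formula for the derivative of the
metric coefficients along coordinate vector fields.
\<close>

lemma gram_has_derivative:
  assumes R: "riemannian_manifold M" and p: "p \<in> pts M"
  defines "c \<equiv> chart_at M p"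
  shows "((\<lambda>y. \<Sum>i\<in>UNIV. \<Sum>j\<in>UNIV. gram M c y $ i $ j * v $ i * w $ j) has_derivative
     (\<lambda>u. metric M p (christoffel_form M c p u v) w + metric M p v (christoffel_form M c p u w)))
     (at (snd c p))"
proof -
  have M: "smooth_manifold M" using R by (simp add: riemannian_manifold_def)
  have c: "c \<in> atlas M" "p \<in> fst c" unfolding c_def by (rule chart_at[OF M p])+
  have x: "snd c p \<in> crange c" using c by (simp add: crange_def)
  let ?k = "\<lambda>y. \<Sum>i\<in>UNIV. \<Sum>j\<in>UNIV. gram M c y $ i $ j * v $ i * w $ j"
  let ?h = "(\<lambda>q. metric M q (extend M p v q) (extend M p w q)) \<circ> cinv c"
  have "?k differentiable (at (snd c p))"
    using gram_entry_differentiable[OF R c(1) x] by simp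
  then have dk: "(?k has_derivative frechet_derivative ?k (at (snd c p))) (at (snd c p))"
    by (simp add: frechet_derivative_works)
  have "(?h has_derivative frechet_derivative ?k (at (snd c p))) (at (snd c p))"
    by (rule has_derivative_transform_within_open[OF dk crange_open[OF M c(1)] x])
       (simp add: extend_def c_def[symmetric] gram_expand[OF R c(1)])
  then have "frechet_derivative ?h (at (snd c p)) = frechet_derivative ?k (at (snd c p))"
    by (rule frechet_derivative_at[symmetric])
  moreover have "frechet_derivative ?h (at (snd c p)) u =
      metric M p (christoffel_form M c p u v) w + metric M p v (christoffel_form M c p u w)" for u
    using levi_civita_metric[OF R p, of u v w]
    by (simp add: nabla2_def dfun_def levi_civita_extend[OF M p] c_def)
  ultimately show ?thesis using dk by (metis (no_types, lifting) ext)
qed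

text \<open>
Covariant differentiation commutes with the trace. The orthonormal basis at \<open>p\<close> is extended
with constant coordinates to a frame \<open>E\<close>, orthonormal at \<open>p\<close> but in general not nearby; the derivative of its
Gram matrix \<open>P\<close> contributes exactly the connection terms that turn the derivatives of the components
\<open>\<phi>(E\<^sub>i, E\<^sub>i)\<close> into \<open>(\<nabla>\<^sub>u \<phi>)(e\<^sub>i, e\<^sub>i)\<close>.
\<close>

theorem dfun_trace_g:
  fixes M :: "('a, 'n::finite) rmanifold"
  assumes R: "riemannian_manifold M" and p: "p \<in> pts M" and e: "ortho_basis M p e"
    and bil: "\<And>q. q \<in> pts M \<Longrightarrow> bilinear (\<phi> q)"
    and diff: "\<And>v w. ((\<lambda>q. \<phi> q (extend M p v q) (extend M p w q)) \<circ> cinv (chart_at M p))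
                        differentiable (at (snd (chart_at M p) p))"
  shows "dfun M (\<lambda>q. trace_g M q (\<phi> q)) p u = (\<Sum>i\<in>UNIV. nabla2 M \<phi> p u (e i) (e i))"
proof -
  have M: "smooth_manifold M" using R by (simp add: riemannian_manifold_def)
  define c where "c = chart_at M p"
  have c: "c \<in> atlas M" "p \<in> fst c" unfolding c_def by (rule chart_at[OF M p])+
  define x where "x = snd c p"
  have x: "x \<in> crange c" and cx: "cinv c x = p"
    using c cinv_chart[OF M c] by (simp_all add: crange_def x_def)
  let ?G = "christoffel_form M c p"
  define E where "E v y = extend M p v (cinv c y)" for v y
  have Ex: "E v x = v" for v by (simp add: E_def cx extend_at_point[OF M p])
  define P where "P y = (\<chi> i j. metric M (cinv c y) (E (e i) y) (E (e j) y))" for y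
  define \<Phi> where "\<Phi> y = (\<chi> i j. \<phi> (cinv c y) (E (e i) y) (E (e j) y))" for y
  define P' where "P' i j u = metric M p (?G u (e i)) (e j) + metric M p (e i) (?G u (e j))" for i j u
  define \<Phi>' where "\<Phi>' i j u = nabla2 M \<phi> p u (e i) (e j) + \<phi> p (?G u (e i)) (e j) + \<phi> p (e i) (?G u (e j))" for i j u
  have dP: "((\<lambda>y. P y $ i $ j) has_derivative P' i j) (at x)" for i j
  proof -
    have "((\<lambda>y. \<Sum>k\<in>UNIV. \<Sum>l\<in>UNIV. gram M c y $ k $ l * e i $ k * e j $ l) has_derivative P' i j) (at x)"
      using gram_has_derivative[OF R p, of "e i" "e j"] unfolding P'_def[abs_def] x_def c_def .
    then show ?thesis
      by (rule has_derivative_transform_within_open[OF _ crange_open[OF M c(1)] x])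
         (simp add: P_def E_def extend_def c_def[symmetric] gram_expand[OF R c(1)])
  qed
  have d\<Phi>: "((\<lambda>y. \<Phi> y $ i $ j) has_derivative \<Phi>' i j) (at x)" for i j
  proof -
    have eq: "(\<lambda>y. \<Phi> y $ i $ j) = (\<lambda>q. \<phi> q (extend M p (e i) q) (extend M p (e j) q)) \<circ> cinv c"
      by (simp add: \<Phi>_def E_def fun_eq_iff)
    have "frechet_derivative (\<lambda>y. \<Phi> y $ i $ j) (at x) = \<Phi>' i j"
      by (simp add: eq \<Phi>'_def fun_eq_iff nabla2_def dfun_def levi_civita_extend[OF M p] x_def c_def)
    then show ?thesis
      using diff[of "e i" "e j"] unfolding c_def[symmetric] x_def[symmetric] eq[symmetric]
        frechet_derivative_works by simp
  qed
  have Px: "P x = mat 1"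
    using e by (simp add: P_def Ex cx ortho_basis_def mat_def)
  have tr: "((\<lambda>y. trace_g M (cinv c y) (\<phi> (cinv c y))) has_derivative
      (\<lambda>h. (\<Sum>i\<in>UNIV. \<Phi>' i i h) - (\<Sum>i\<in>UNIV. \<Sum>j\<in>UNIV. \<Phi> x $ i $ j * P' j i h))) (at x)"
  proof (rule has_derivative_trace_matrix_inverse[OF dP Px d\<Phi> crange_open[OF M c(1)] x])
    fix y and Q :: "real ^ 'n ^ 'n"
    assume y: "y \<in> crange c" and Q: "P y ** Q = mat 1"
    have q: "cinv c y \<in> pts M" using cinv_in[OF y] chart_subset[OF M c(1)] by blast
    show "trace_g M (cinv c y) (\<phi> (cinv c y)) = trace (\<Phi> y ** Q)"
      unfolding \<Phi>_def by (rule trace_g_frame[OF R q bil[OF q] Q[unfolded P_def]])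
  qed
  have lin: "linear (\<lambda>z. \<phi> p z w)" "linear (\<phi> p w)" for w
    using bil[OF p] by (simp_all add: bilinear_def)
  have sym: "metric M p v w = metric M p w v" for v w
    using R p by (simp add: riemannian_manifold_def)
  \<comment> \<open>The derivative of the Gram matrix consists of components of \<open>\<nabla>\<^sub>u E\<^sub>i\<close>; summed against \<open>\<phi>\<close> they reassemble \<open>\<nabla>\<^sub>u E\<^sub>i\<close>.\<close>
  have 1: "(\<Sum>j\<in>UNIV. \<phi> p (e i) (e j) * metric M p (e j) (?G u (e i))) = \<phi> p (e i) (?G u (e i))" for i
    by (subst (3) orthonormal_expansion[OF R p e])
       (simp add: linear_sum[OF lin(2)] linear_cmul[OF lin(2)] sym[of _ "?G u (e i)"] mult_ac)
  have 2: "(\<Sum>i\<in>UNIV. \<phi> p (e i) (e j) * metric M p (?G u (e j)) (e i)) = \<phi> p (?G u (e j)) (e j)" for j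
    by (subst (2) orthonormal_expansion[OF R p e])
       (simp add: linear_sum[OF lin(1)] linear_cmul[OF lin(1)] mult_ac)
  have "(\<Sum>i\<in>UNIV. \<Sum>j\<in>UNIV. \<Phi> x $ i $ j * P' j i u)
      = (\<Sum>i\<in>UNIV. \<Sum>j\<in>UNIV. \<phi> p (e i) (e j) * metric M p (?G u (e j)) (e i))
        + (\<Sum>i\<in>UNIV. \<Sum>j\<in>UNIV. \<phi> p (e i) (e j) * metric M p (e j) (?G u (e i)))"
    by (simp add: \<Phi>_def P'_def Ex cx distrib_left sum.distrib)
  also have "\<dots> = (\<Sum>i\<in>UNIV. \<phi> p (?G u (e i)) (e i)) + (\<Sum>i\<in>UNIV. \<phi> p (e i) (?G u (e i)))"
    by (subst sum.swap) (simp only: 1 2)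
  finally have "(\<Sum>i\<in>UNIV. \<Phi>' i i u) - (\<Sum>i\<in>UNIV. \<Sum>j\<in>UNIV. \<Phi> x $ i $ j * P' j i u)
      = (\<Sum>i\<in>UNIV. nabla2 M \<phi> p u (e i) (e i))"
    by (simp add: \<Phi>'_def sum.distrib)
  moreover have "dfun M (\<lambda>q. trace_g M q (\<phi> q)) p u
      = (\<Sum>i\<in>UNIV. \<Phi>' i i u) - (\<Sum>i\<in>UNIV. \<Sum>j\<in>UNIV. \<Phi> x $ i $ j * P' j i u)"
    using fun_cong[OF frechet_derivative_at[OF tr], of u]
    by (simp add: dfun_def c_def x_def comp_def)
  ultimately show ?thesis by simp
qed

section \<open>The second fundamental form of a map and the pullback metric\<close>

text \<open>
Everything that follows is a computation at one point \<open>p\<close>, in the charts \<open>c\<close> at \<open>p\<close> and \<open>d\<close> at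
\<open>f p\<close> in which the definitions of the connections are written. The point \<open>p\<close> has coordinates \<open>x\<close>,
and \<open>F\<close> is the coordinate expression of \<open>f\<close>, defined near \<open>x\<close> on \<open>U\<close>.
\<close>

locale smooth_map_at =
  fixes M :: "('a, 'n::finite) rmanifold" and N :: "('b, 'm::finite) rmanifold"
    and f :: "'a \<Rightarrow> 'b" and p :: 'a
  assumes RM: "riemannian_manifold M" and RN: "riemannian_manifold N"
    and f: "smooth_map M N f" and p: "p \<in> pts M"
begin

abbreviation "c \<equiv> chart_at M p"
abbreviation "d \<equiv> chart_at N (f p)"
abbreviation "x \<equiv> snd c p"
abbreviation "U \<equiv> snd c ` (fst c \<inter> f -` fst d)"
abbreviation "F \<equiv> local_rep c d f"
abbreviation "DF y \<equiv> frechet_derivative F (at y)"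
abbreviation "df \<equiv> differential M N f p"
abbreviation "Ddf \<equiv> D_differential M N f p"
abbreviation "Hess u v \<equiv> frechet_derivative (\<lambda>y. DF y v) (at x) u"

lemma M: "smooth_manifold M" and N: "smooth_manifold N"
  using RM RN by (simp_all add: riemannian_manifold_def)

lemma fp: "f p \<in> pts N" by (rule smooth_map_in_pts[OF f p])

lemmas chart_p = chart_at[OF M p] and chart_fp = chart_at[OF N fp]

lemma U: "open U" "x \<in> U"
  using local_rep_domain_open[OF M N f chart_p(1) chart_fp(1)] chart_p(2) chart_fp(2) by auto

lemma F_Ck: "Ck_on k U F"
  using f chart_p(1) chart_fp(1) unfolding smooth_map_def smooth_on_def local_rep_def by blast

lemma DF_has_derivative: "((\<lambda>y. DF y v) has_derivative (\<lambda>u. Hess u v)) (at x)"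
  using F_Ck[of "Suc (Suc 0)"] U(2) unfolding Ck_on.simps frechet_derivative_works by blast

lemma F_has_derivative: "y \<in> U \<Longrightarrow> (F has_derivative DF y) (at y)"
  using F_Ck[of "Suc 0"] unfolding Ck_on.simps frechet_derivative_works by blast

lemma df_eq: "df = DF x"
  by (simp add: differential_local_rep)

lemma chart_domainD:
  assumes "y \<in> U"
  shows "cinv c y \<in> fst c" "f (cinv c y) \<in> fst d" "snd c (cinv c y) = y" "cinv d (F y) = f (cinv c y)" "F y \<in> crange d"
  using assms by (auto simp: cinv_chart[OF M chart_p(1)] cinv_chart[OF N chart_fp(1)] local_rep_def crange_def)

text \<open>
The coordinate vector field with constant components \<open>v\<close> is pushed forward to the vector field
along \<open>f\<close> whose components in the chart \<open>d\<close> are \<open>DF y v\<close>.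
\<close>

lemma push_forward_extend:
  assumes "y \<in> U"
  shows "differential M N f (cinv c y) (extend M p v (cinv c y)) = tan_vec N d (f (cinv c y)) (DF y v)"
  using differential_tan_vec[OF M N f chart_p(1) chart_domainD(1)[OF assms] chart_fp(1) chart_domainD(2)[OF assms]]
  by (simp add: extend_def chart_domainD(3)[OF assms])

text \<open>
The classical coordinate formula for the second fundamental form of a map:
the Hessian of its components, corrected by the Christoffel symbols of target and source.
\<close>

lemma D_differential_eq:
  "Ddf u v = Hess u v + christoffel_form N d (f p) (df u) (df v) - df (christoffel_form M c p u v)"
proof -
  let ?V = "\<lambda>q. tan_comp N d (f q) (differential M N f q (extend M p v q))"
  have "(?V \<circ> cinv c has_derivative (\<lambda>u. Hess u v)) (at x)"
    by (rule has_derivative_transform_within_open[OF DF_has_derivative U])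
       (simp add: push_forward_extend tan_comp_tan_vec[OF N chart_fp(1)] chart_domainD)
  then have "dfun M ?V p u = Hess u v"
    unfolding dfun_def by (rule fun_cong[OF frechet_derivative_at[symmetric]])
  then show ?thesis
    by (simp add: D_differential_def pullback_conn_def Let_def levi_civita_extend[OF M p] extend_at_point[OF M p])
qed

text \<open>
All three terms of the coordinate formula are symmetric: the Hessian by Schwarz's theorem and the
two Christoffel terms because the connections are torsion-free.
\<close>

lemma D_differential_symmetric: "Ddf u v = Ddf v u"
  unfolding D_differential_eq
  by (simp only: symmetric_second_derivative[OF U F_Ck] christoffel_form_symmetric[OF RM p, of u v]
      christoffel_form_symmetric[OF RN fp, of "df u" "df v"])

lemma metric_N_linear: "linear (metric N (f p) a)" "linear (\<lambda>a. metric N (f p) a b)"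
  using RN fp by (simp_all add: riemannian_manifold_def bilinear_def)

text \<open>
In coordinates the pullback metric is \<open>\<Sum>\<^sub>i\<^sub>j g\<^sub>i\<^sub>j(F y) (DF y v)\<^sub>i (DF y w)\<^sub>j\<close>. By the product
rule, the factors \<open>DF\<close> contribute Hessians, while the derivative of \<open>g\<^sub>i\<^sub>j(F y)\<close> supplies, by
compatibility of the target connection with its metric, the Christoffel terms that complete them to
covariant derivatives.
\<close>

lemma pullback_metric_has_derivative:
  "((\<lambda>q. pullback_metric M N f q (extend M p v q) (extend M p w q)) \<circ> cinv c has_derivative
    (\<lambda>u. metric N (f p) (Hess u v + christoffel_form N d (f p) (df u) (df v)) (df w)
       + metric N (f p) (df v) (Hess u w + christoffel_form N d (f p) (df u) (df w)))) (at x)"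
proof -
  let ?g = "\<lambda>i j y. gram N d y $ i $ j"
  let ?h = "(\<lambda>q. pullback_metric M N f q (extend M p v q) (extend M p w q)) \<circ> cinv c"
  let ?G = "christoffel_form N d (f p)"
  have Fx: "F x = snd d (f p)" by (simp add: local_rep_def cinv_chart[OF M chart_p])
  have Fxr: "F x \<in> crange d" by (rule chart_domainD(5)[OF U(2)])
  define g' where "g' i j = frechet_derivative (?g i j) (at (F x))" for i j
  have g: "(?g i j has_derivative g' i j) (at (F x))" for i j
    using gram_entry_differentiable[OF RN chart_fp(1) Fxr] by (simp add: g'_def frechet_derivative_works[symmetric])
  have gF: "((\<lambda>y. ?g i j (F y)) has_derivative (\<lambda>u. g' i j (DF x u))) (at x)" for i j
    by (rule has_derivative_compose[OF F_has_derivative[OF U(2)] g])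
  have dV: "((\<lambda>y. DF y a $ i) has_derivative (\<lambda>u. Hess u a $ i)) (at x)" for a i
    by (rule bounded_linear.has_derivative[OF bounded_linear_vec_nth DF_has_derivative])
  have g'_eq: "(\<Sum>i\<in>UNIV. \<Sum>j\<in>UNIV. g' i j z * a $ i * b $ j)
      = metric N (f p) (?G z a) b + metric N (f p) a (?G z b)" for z a b
  proof -
    have "((\<lambda>y. \<Sum>i\<in>UNIV. \<Sum>j\<in>UNIV. ?g i j y * a $ i * b $ j) has_derivative
       (\<lambda>z. \<Sum>i\<in>UNIV. \<Sum>j\<in>UNIV. g' i j z * a $ i * b $ j)) (at (F x))"
      by (intro has_derivative_sum has_derivative_mult_left g)
    from fun_cong[OF has_derivative_unique[OF this[unfolded Fx] gram_has_derivative[OF RN fp]]]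
    show ?thesis .
  qed
  have met: "metric N (f p) a b = (\<Sum>i\<in>UNIV. \<Sum>j\<in>UNIV. ?g i j (F x) * a $ i * b $ j)" for a b
    unfolding Fx by (rule metric_expand[OF RN fp])
  have "((\<lambda>y. \<Sum>i\<in>UNIV. \<Sum>j\<in>UNIV. ?g i j (F y) * DF y v $ i * DF y w $ j) has_derivative
     (\<lambda>u. \<Sum>i\<in>UNIV. \<Sum>j\<in>UNIV. (?g i j (F x) * DF x v $ i) * Hess u w $ j
        + (?g i j (F x) * Hess u v $ i + g' i j (DF x u) * DF x v $ i) * DF x w $ j)) (at x)"
    by (intro has_derivative_sum has_derivative_mult gF dV)
  moreover have "(\<Sum>i\<in>UNIV. \<Sum>j\<in>UNIV. (?g i j (F x) * DF x v $ i) * Hess u w $ j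
        + (?g i j (F x) * Hess u v $ i + g' i j (DF x u) * DF x v $ i) * DF x w $ j)
      = metric N (f p) (Hess u v + ?G (df u) (df v)) (df w)
       + metric N (f p) (df v) (Hess u w + ?G (df u) (df w))" for u
    using g'_eq[of "DF x u" "DF x v" "DF x w"]
    by (simp add: df_eq linear_add[OF metric_N_linear(1)] linear_add[OF metric_N_linear(2)]
        met[of "DF x v" "Hess u w"] met[of "Hess u v" "DF x w"] distrib_right sum.distrib)
  ultimately have "((\<lambda>y. \<Sum>i\<in>UNIV. \<Sum>j\<in>UNIV. ?g i j (F y) * DF y v $ i * DF y w $ j) has_derivative
     (\<lambda>u. metric N (f p) (Hess u v + ?G (df u) (df v)) (df w)
       + metric N (f p) (df v) (Hess u w + ?G (df u) (df w)))) (at x)"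
    by simp
  then show ?thesis
  proof (rule has_derivative_transform_within_open[OF _ U])
    fix y assume y: "y \<in> U"
    show "(\<Sum>i\<in>UNIV. \<Sum>j\<in>UNIV. ?g i j (F y) * DF y v $ i * DF y w $ j) = ?h y"
      using gram_expand[OF RN chart_fp(1) chart_domainD(5)[OF y], of "DF y v" "DF y w"]
      by (simp add: pullback_metric_def push_forward_extend[OF y] chart_domainD(4)[OF y])
  qed
qed

text \<open>
The Leibniz rule for \<open>f\<^sup>*g\<close>: the Christoffel terms of the source that enter through \<open>\<nabla>\<close> on
2-tensors are the ones that are missing from the second fundamental form.
\<close>

lemma nabla2_pullback_metric:
  "nabla2 M (pullback_metric M N f) p u v w = metric N (f p) (Ddf u v) (df w) + metric N (f p) (df v) (Ddf u w)"
proof -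
  have "dfun M (\<lambda>q. pullback_metric M N f q (extend M p v q) (extend M p w q)) p u
     = metric N (f p) (Hess u v + christoffel_form N d (f p) (df u) (df v)) (df w)
       + metric N (f p) (df v) (Hess u w + christoffel_form N d (f p) (df u) (df w))"
    unfolding dfun_def by (rule fun_cong[OF frechet_derivative_at[OF pullback_metric_has_derivative, symmetric]])
  then show ?thesis
    by (simp add: nabla2_def levi_civita_extend[OF M p] D_differential_eq pullback_metric_def
        linear_diff[OF metric_N_linear(1)] linear_diff[OF metric_N_linear(2)])
qed

text \<open>
The identity \<open>\<delta>g\<^sup>* = - \<langle>\<tau>(f), f\<^sub>* \<cdot>\<rangle> - 1/2 d e(f)\<close>, valid for every smooth map. Tracing the
Leibniz rule over the first two arguments gives the tension term and
\<open>\<Sum>\<^sub>i \<langle>f\<^sub>*e\<^sub>i, (D f\<^sub>*)(e\<^sub>i, w)\<rangle>\<close>; tracing it over the last two gives \<open>d e(f) w\<close> as twice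
\<open>\<Sum>\<^sub>i \<langle>f\<^sub>*e\<^sub>i, (D f\<^sub>*)(w, e\<^sub>i)\<rangle>\<close>, and the two sums agree by the symmetry of \<open>D f\<^sub>*\<close>.
\<close>

theorem divergence_pullback_metric:
  "divergence M (pullback_metric M N f) p w =
     - metric N (f p) (tension M N f p) (df w) - 1/2 * dfun M (energy_density M N f) p w"
proof -
  \<comment> \<open>The basis used by \<open>trace_g\<close> at \<open>p\<close>: divergence, tension and the derivative of the energy density all become sums over it.\<close>
  define e where "e = (SOME e. ortho_basis M p e)"
  have e: "ortho_basis M p e" unfolding e_def by (rule someI_ex[OF ex_ortho_basis[OF RM p]])
  have sym: "metric N (f p) a b = metric N (f p) b a" for a b
    using RN fp by (simp add: riemannian_manifold_def)
  have bil: "bilinear (pullback_metric M N f q)" if "q \<in> pts M" for q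
  proof -
    have "bilinear (metric N (f q))"
      using RN smooth_map_in_pts[OF f that] by (simp add: riemannian_manifold_def)
    then show ?thesis
      using linear_compose[OF linear_differential[OF M N f that], of "metric N (f q) (differential M N f q a)" for a]
        linear_compose[OF linear_differential[OF M N f that], of "\<lambda>z. metric N (f q) z (differential M N f q a)" for a]
      by (simp add: bilinear_def pullback_metric_def comp_def)
  qed
  have "dfun M (energy_density M N f) p w
      = dfun M (\<lambda>q. trace_g M q (pullback_metric M N f q)) p w"
    by (simp add: energy_density_def[abs_def])
  also have "\<dots> = (\<Sum>i\<in>UNIV. nabla2 M (pullback_metric M N f) p w (e i) (e i))"
    by (rule dfun_trace_g[OF RM p e bil differentiableI[OF pullback_metric_has_derivative]])
  also have "\<dots> = 2 * (\<Sum>i\<in>UNIV. metric N (f p) (df (e i)) (Ddf (e i) w))"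
    by (simp add: nabla2_pullback_metric sym[of "Ddf _ w"] D_differential_symmetric[of w] sum_distrib_left)
  finally have 1: "dfun M (energy_density M N f) p w
      = 2 * (\<Sum>i\<in>UNIV. metric N (f p) (df (e i)) (Ddf (e i) w))" .
  have "tension M N f p = (\<Sum>i\<in>UNIV. Ddf (e i) (e i))"
    by (simp add: tension_def trace_g_def e_def Let_def)
  then have "metric N (f p) (tension M N f p) (df w) = (\<Sum>i\<in>UNIV. metric N (f p) (Ddf (e i) (e i)) (df w))"
    by (simp add: linear_sum[OF metric_N_linear(2)])
  then show ?thesis
    by (simp add: divergence_def trace_g_def Let_def e_def[symmetric] nabla2_pullback_metric 1 sum.distrib)
qed

lemma tension_eq_0_iff:
  assumes "surj df"
  shows "tension M N f p = 0 \<longleftrightarrow> (\<forall>w. metric N (f p) (tension M N f p) (df w) = 0)"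
proof
  assume *: "\<forall>w. metric N (f p) (tension M N f p) (df w) = 0"
  obtain w where "tension M N f p = df w" using assms by blast
  with * have "metric N (f p) (tension M N f p) (tension M N f p) = 0" by metis
  then show "tension M N f p = 0" using RN fp unfolding riemannian_manifold_def by (metis less_irrefl)
qed (simp add: linear_0[OF metric_N_linear(2)])

end

section \<open>Harmonic maps and the divergence of the pullback metric\<close>

theorem theorem1:
  fixes M :: "('a, 'n::finite) rmanifold" and N :: "('b, 'm::finite) rmanifold" and f :: "'a \<Rightarrow> 'b"
  assumes "riemannian_manifold M" and "compact_space (mtop M)" and "CARD('n) \<ge> 2"
    and "riemannian_manifold N" and "CARD('m) \<ge> 2"
    and "smooth_map M N f"
  shows "(harmonic M N f \<longrightarrow>
            (\<forall>p\<in>pts M. \<forall>v. divergence M (pullback_metric M N f) p v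
               = - (1/2) * dfun M (energy_density M N f) p v)) \<and>
         ((\<forall>p\<in>pts M. \<forall>v. divergence M (pullback_metric M N f) p v
               = - (1/2) * dfun M (energy_density M N f) p v) \<and>
          ((CARD('n) = CARD('m) \<and> diffeomorphism M N f) \<or>
           (CARD('n) > CARD('m) \<and> submersion M N f)) \<longrightarrow>
            harmonic M N f)"
proof -
  have at: "smooth_map_at M N f p" if "p \<in> pts M" for p
    using assms that by unfold_locales
  have eq: "divergence M (pullback_metric M N f) p v = - (1/2) * dfun M (energy_density M N f) p v
      \<longleftrightarrow> metric N (f p) (tension M N f p) (differential M N f p v) = 0" if "p \<in> pts M" for p v
    using smooth_map_at.divergence_pullback_metric[OF at[OF that], of v] by auto
  have surj: "surj (differential M N f p)"
    if "diffeomorphism M N f \<or> submersion M N f" "p \<in> pts M" for p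
    using that surj_differential_diffeomorphism[of M N f p] assms(1,4)
    by (auto simp: submersion_def riemannian_manifold_def)
  have harmonic: "divergence M (pullback_metric M N f) p v = - (1/2) * dfun M (energy_density M N f) p v"
    if "harmonic M N f" "p \<in> pts M" for p v
    using that unfolding eq[OF that(2)]
    by (simp add: harmonic_def linear_0[OF smooth_map_at.metric_N_linear(2)[OF at]])
  have converse: "harmonic M N f"
    if "\<forall>p\<in>pts M. \<forall>v. divergence M (pullback_metric M N f) p v = - (1/2) * dfun M (energy_density M N f) p v"
      and "diffeomorphism M N f \<or> submersion M N f"
    unfolding harmonic_def
  proof
    fix p assume p: "p \<in> pts M"
    have "\<forall>w. metric N (f p) (tension M N f p) (differential M N f p w) = 0"
      using that(1) p eq[OF p] by blast
    then show "tension M N f p = 0"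
      using smooth_map_at.tension_eq_0_iff[OF at[OF p] surj[OF that(2) p]] by blast
  qed
  show ?thesis using harmonic converse by blast
qed

end
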